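(* Let $\mathbb{P}$ be a semifield and let $(\mathbf{x},\mathbf{y},B,\mathbf{Z})$ be a generalized seed over $\mathbb{P}$, with $d_i=\deg Z_i$ and $D=(d_i\delta_{ij})$, placed at the initial vertex $t_0$ of $\mathbb{T}_n$. Let $c^t_{ij}$, $g^t_{ij}$, $F^t_j(\mathbf{y},\mathbf{z})$ be its $c$-vector entries, $g$-vector entries and $F$-polynomials, and let $B^t=(b^t_{ij})$ be its exchange matrices. Let $z^{\mathrm{bin}}_{i,s}=\binom{d_i}{s}$, $\mathbf{z}^{\mathrm{bin}}=(z^{\mathrm{bin}}_{i,s})$, $\hat y_k=y_k\prod_{i=1}^n x_i^{b_{ik}}$, and define $$x_j^t\big|_{\mathbf{z}=\mathbf{z}^{\mathrm{bin}}}=\Big(\prod_{i=1}^n x_i^{g^t_{ij}}\Big)\frac{F^t_j(\hat{\mathbf{y}},\mathbf{z}^{\mathrm{bin}})}{F^t_j(\cdot,\mathbf{z}^{\mathrm{bin}})\big|_{\mathbb{P}}(\mathbf{y})},\qquad y_j^t\big|_{\mathbf{z}=\mathbf{z}^{\mathrm{bin}}}=\Big(\prod_{i=1}^n y_i^{c^t_{ij}}\Big)\prod_{i=1}^n \Big(F^t_i(\cdot,\mathbf{z}^{\mathrm{bin}})\big|_{\mathbb{P}}(\mathbf{y})\Big)^{b^t_{ij}},$$ where $F^t_j(\cdot,\mathbf{z}^{\mathrm{bin}})$ is regarded as an element of $\mathbb{Q}_{\mathrm{sf}}(y_1,\dots,y_n)$ when it is evaluated in $\mathbb{P}$. Let $({}^L\mathbf{x}^t,{}^L\mathbf{y}^t,{}^LB^t)$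 be the seed at $t\in\mathbb{T}_n$ of the left-companion cluster algebra, i.e. of the ordinary cluster pattern over $\mathbb{P}$ with initial seed $(\mathbf{x}^{1/\mathbf{d}},\mathbf{y},DB)$ at $t_0$, where $\mathbf{x}^{1/\mathbf{d}}=(x_1^{1/d_1},\dots,x_n^{1/d_n})$, in the field $\mathbb{QP}(\mathbf{x}^{1/\mathbf{d}})\supset\mathbb{QP}(\mathbf{x})$. Then for all $t\in\mathbb{T}_n$ and all $1\le i,j\le n$: $$x_i^t\big|_{\mathbf{z}=\mathbf{z}^{\mathrm{bin}}}=\big({}^Lx^t_i\big)^{d_i}\qquad\text{and}\qquad y_j^t\big|_{\mathbf{z}=\mathbf{z}^{\mathrm{bin}}}={}^Ly^t_j .$$
   Context: Semifields. A semifield is a multiplicative abelian group $\mathbb{P}$ with an associative, commutative operation $\oplus$ over which multiplication distributes. $\mathbb{P}$ is torsion-free, $\mathbb{ZP}$ is its group ring (a domain), $\mathbb{QP}$ its field of fractions. $\mathbb{Q}_{\mathrm{sf}}(u_1,\dots,u_m)$ is the universal semifield of rational functions in $u_1,\dots,u_m$ that can be written in subtraction-free form (usual operations). $\mathrm{Trop}(u_1,\dots,u_m)$ is the free abelian multiplicative group on the $u_j$ with $\prod u_j^{a_j}\oplus\prod u_j^{b_j}=\prod u_j^{\min(a_j,b_j)}$. For $f\in\mathbb{Q}_{\mathrm{sf}}(u_1,\dots,u_m)$ and $p_1,\dots,p_m\in\mathbb{P}$, $f|_{\mathbb{P}}(p_1,\dots,p_m)\in\mathbb{P}$ is the image of $f$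 under the semifield homomorphism $\mathbb{Q}_{\mathrm{sf}}(u_1,\dots,u_m)\to\mathbb{P}$ with $u_i\mapsto p_i$, $1\mapsto 1$ (so a positive integer $N$ maps to $1\oplus\cdots\oplus1$, $N$ terms). Write $[b]_+=\max(b,0)$. Generalized seeds. A generalized seed $(\mathbf{x},\mathbf{y},B,\mathbf{Z})$ over $\mathbb{P}$ consists of: algebraically independent elements $\mathbf{x}=(x_1,\dots,x_n)$ (cluster variables) of a degree-$n$ purely transcendental extension $\mathcal{F}$ of $\mathbb{QP}$ (identified with $\mathbb{QP}(\mathbf{x})$); $\mathbf{y}=(y_1,\dots,y_n)\in\mathbb{P}^n$ (coefficients); a skew-symmetrizable integer $n\times n$ matrix $B=(b_{ij})$; and polynomials $\mathbf{Z}=(Z_1,\dots,Z_n)$, $Z_i(u)=\sum_{s=0}^{d_i}z_{i,s}u^s$ with $d_i\ge1$, $z_{i,s}\in\mathbb{P}$, $z_{i,0}=z_{i,d_i}=1$. Put $\mathbf{z}=(z_{i,s})$ and $Z_i|_{\mathbb{P}}(y)=\bigoplus_{s=0}^{d_i}z_{i,s}y^s$ for $y\in\mathbb{P}$. Mutation. $\mu_k(\mathbf{x},\mathbf{y},B,\mathbf{Z})=(\mathbf{x}',\mathbf{y}',B',\mathbf{Z}')$, where $x_i'=x_i$ for $i\ne k$ and $x_k'x_k=\big(\prod_i x_i^{[-b_{ik}]_+}\big)^{d_k}\frac{Z_k(\hat y_k)}{Z_k|_{\mathbb{P}}(y_k)}$ with $\hat y_k=y_k\prod_i x_i^{b_{ik}}$;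 $y_k'=y_k^{-1}$ and $y_j'=y_j(y_k^{d_k})^{[b_{kj}]_+}Z_k|_{\mathbb{P}}(y_k)^{-b_{kj}}$ for $j\ne k$; $b'_{ij}=-b_{ij}$ if $i=k$ or $j=k$, and $b'_{ij}=b_{ij}+[b_{ik}]_+d_kb_{kj}+b_{ik}d_k[-b_{kj}]_+$ otherwise; $Z_i'=Z_i$ for $i\neq k$ and $Z_k'(u)=u^{d_k}Z_k(u^{-1})$. Patterns. $\mathbb{T}_n$ is the $n$-regular tree with edges labeled by $1,\dots,n$ so that the edges at each vertex have distinct labels. A generalized cluster pattern assigns to each $t\in\mathbb{T}_n$ a generalized seed $(\mathbf{x}^t,\mathbf{y}^t,B^t,\mathbf{Z}^t)$ so that seeds at the ends of an edge labeled $k$ are related by $\mu_k$; it is determined by the seed at the initial vertex $t_0$ (for which the superscript is dropped). An ordinary seed $(\mathbf{x},\mathbf{y},B)$ and its ordinary cluster pattern are the special case $Z_i(u)=1+u$ for all $i$ (so all $d_i=1$). $c$-vectors, $g$-vectors, $F$-polynomials. Regard $x_i$, $y_i$ and $z_{i,s}$ ($0<s<d_i$) as independent indeterminates. $Y$-functions $Y_j^t\in\mathbb{Q}_{\mathrm{sf}}(\mathbf{y},\mathbf{z})$ are the coefficients obtained by performing the $y$-mutations in $\mathbb{P}=\mathbb{Q}_{\mathrm{sf}}(\mathbf{y},\mathbf{z})$. Their images in $\mathrm{Trop}(\mathbf{y},\mathbf{z})$ are monomials $\prod_i y_i^{c^t_{ij}}$; the vectors $\mathbf{c}^t_j=(c^t_{ij})_i$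 are the $c$-vectors. $X$-functions $X^t_i\in\mathbb{Q}(\mathbf{x},\mathbf{y},\mathbf{z})$ are the cluster variables obtained by taking $\mathbb{P}=\mathrm{Trop}(\mathbf{y},\mathbf{z})$; one has $X_i^t\in\mathbb{Z}[\mathbf{x}^{\pm1},\mathbf{y},\mathbf{z}]$. For the $\mathbb{Z}^n$-grading $\deg x_i=\mathbf{e}_i$, $\deg y_j=-(j\text{-th column of }B)$, $\deg z_{i,s}=0$, each $X_j^t$ is homogeneous, and its degree $\mathbf{g}^t_j=(g^t_{ij})_i$ is the $g$-vector. $F$-polynomials are $F^t_j(\mathbf{y},\mathbf{z})=X^t_j|_{x_1=\cdots=x_n=1}\in\mathbb{Z}[\mathbf{y},\mathbf{z}]$; they admit subtraction-free expressions. *)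

theory Defs
  imports
    "HOL-Library.Poly_Mapping"
    "HOL-Library.Product_Lexorder"
    "HOL-Computational_Algebra.Fraction_Field"
begin

section \<open>Semifields\<close>

class semifield = comm_monoid_mult + inverse +
  fixes oplus :: "'a \<Rightarrow> 'a \<Rightarrow> 'a"  (infixl \<open>\<oplus>\<close> 65)
  assumes sf_left_inverse: "inverse a * a = 1"
    and sf_divide: "a / b = a * inverse b"
    and oplus_assoc: "(a \<oplus> b) \<oplus> c = a \<oplus> (b \<oplus> c)"
    and oplus_commute: "a \<oplus> b = b \<oplus> a"
    and sf_distrib: "a * (b \<oplus> c) = a * b \<oplus> a * c"

text \<open>\<open>osum f n\<close> is \<open>f 0 \<oplus> \<dots> \<oplus> f n\<close> (a semifield has no zero, so empty sums do not exist).\<close>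

primrec osum :: "(nat \<Rightarrow> 'p::semifield) \<Rightarrow> nat \<Rightarrow> 'p" where
  "osum f 0 = f 0"
| "osum f (Suc n) = osum f n \<oplus> f (Suc n)"

definition semifield_hom :: "('p::semifield \<Rightarrow> 'q::semifield) \<Rightarrow> bool" where
  "semifield_hom h \<longleftrightarrow>
     h 1 = 1 \<and> (\<forall>a b. h (a * b) = h a * h b) \<and> (\<forall>a b. h (a \<oplus> b) = h a \<oplus> h b)"


section \<open>Polynomials and rational functions\<close>

text \<open>\<open>\<rat>(v : v \<in> 'v)\<close> is built as the fraction field of \<open>\<int>[v : v \<in> 'v]\<close>.  The linear order on the
  variables plays no mathematical role: it is what the library asks for in order to know that
  a polynomial ring is an integral domain.\<close>

type_synonym 'v mpoly = "('v \<Rightarrow>\<^sub>0 nat) \<Rightarrow>\<^sub>0 int"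
type_synonym 'v ratfun = "('v mpoly) fract"

definition rf_var :: "'v::linorder \<Rightarrow> 'v ratfun" where
  "rf_var v = Fract (Poly_Mapping.single (Poly_Mapping.single v 1) 1) 1"

definition monom_eval :: "('v \<Rightarrow> 'f::comm_monoid_mult) \<Rightarrow> ('v \<Rightarrow>\<^sub>0 nat) \<Rightarrow> 'f" where
  "monom_eval \<sigma> m = (\<Prod>v\<in>Poly_Mapping.keys m. \<sigma> v ^ Poly_Mapping.lookup m v)"

definition mpoly_eval :: "('v \<Rightarrow> 'f::comm_ring_1) \<Rightarrow> 'v mpoly \<Rightarrow> 'f" where
  "mpoly_eval \<sigma> p = (\<Sum>m\<in>Poly_Mapping.keys p. of_int (Poly_Mapping.lookup p m) * monom_eval \<sigma> m)"

text \<open>Value of a rational function at a point of a field; the value is meaningful when some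
  representation of the rational function as a quotient has a denominator not vanishing there,
  and then it does not depend on the representation.\<close>

definition rf_eval :: "('v::linorder \<Rightarrow> 'f::field) \<Rightarrow> 'v ratfun \<Rightarrow> 'f" where
  "rf_eval \<sigma> f =
     (THE r. \<exists>p q. f = Fract p q \<and> mpoly_eval \<sigma> q \<noteq> 0 \<and> r = mpoly_eval \<sigma> p / mpoly_eval \<sigma> q)"


section \<open>The universal semifield\<close>

inductive subtraction_free :: "'v::linorder ratfun \<Rightarrow> bool" where
  sf_var: "subtraction_free (rf_var v)"
| sf_one: "subtraction_free 1"
| sf_add: "subtraction_free f \<Longrightarrow> subtraction_free g \<Longrightarrow> subtraction_free (f + g)"
| sf_mult: "subtraction_free f \<Longrightarrow> subtraction_free g \<Longrightarrow> subtraction_free (f * g)"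
| sf_div: "subtraction_free f \<Longrightarrow> subtraction_free g \<Longrightarrow> subtraction_free (f / g)"

definition pos_poly :: "'v mpoly \<Rightarrow> bool" where
  "pos_poly p \<longleftrightarrow> p \<noteq> 0 \<and> (\<forall>m. Poly_Mapping.lookup p m \<ge> 0)"

lemma pos_poly_add: "pos_poly p \<Longrightarrow> pos_poly q \<Longrightarrow> pos_poly (p + q)"
  unfolding pos_poly_def poly_mapping_eq_iff fun_eq_iff
  by (auto simp: lookup_add) (metis add_nonneg_eq_0_iff)

lemma pos_poly_single: "pos_poly (Poly_Mapping.single m 1)"
proof -
  have "Poly_Mapping.single m (1 :: int) \<noteq> 0"
    by (metis lookup_single_eq lookup_zero zero_neq_one)
  then show ?thesis by (simp add: pos_poly_def lookup_single when_def)
qed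

lemma pos_poly_one: "pos_poly 1"
  using pos_poly_single[of 0] by simp

lemma pos_poly_mult:
  fixes p q :: "'v::linorder mpoly"
  assumes "pos_poly p" "pos_poly q"
  shows "pos_poly (p * q)"
proof -
  have "Poly_Mapping.lookup (p * q) m \<ge> 0" for m
    using assms unfolding lookup_mult pos_poly_def
    by (auto simp: Sum_any.expand_set when_def intro!: sum_nonneg mult_nonneg_nonneg)
  then show ?thesis using assms by (simp add: pos_poly_def)
qed

lemma subtraction_free_pos:
  "subtraction_free f \<Longrightarrow> \<exists>p q. pos_poly p \<and> pos_poly q \<and> f = Fract p q"
proof (induction rule: subtraction_free.induct)
  case (sf_var v)
  show ?case unfolding rf_var_def using pos_poly_single pos_poly_one by blast
next
  case sf_one
  show ?case unfolding One_fract_def using pos_poly_one by blast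
next
  case (sf_add f g)
  then obtain p q p' q' where *: "pos_poly p" "pos_poly q" "f = Fract p q"
    "pos_poly p'" "pos_poly q'" "g = Fract p' q'" by auto
  have "f + g = Fract (p * q' + p' * q) (q * q')"
    using * by (simp add: pos_poly_def)
  moreover have "pos_poly (p * q' + p' * q)" "pos_poly (q * q')"
    using * by (simp_all add: pos_poly_add pos_poly_mult)
  ultimately show ?case by (intro exI conjI)
next
  case (sf_mult f g)
  then obtain p q p' q' where *: "pos_poly p" "pos_poly q" "f = Fract p q"
    "pos_poly p'" "pos_poly q'" "g = Fract p' q'" by auto
  have "f * g = Fract (p * p') (q * q')"
    using * by (simp add: pos_poly_def)
  moreover have "pos_poly (p * p')" "pos_poly (q * q')"
    using * by (simp_all add: pos_poly_add pos_poly_mult)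
  ultimately show ?case by (intro exI conjI)
next
  case (sf_div f g)
  then obtain p q p' q' where *: "pos_poly p" "pos_poly q" "f = Fract p q"
    "pos_poly p'" "pos_poly q'" "g = Fract p' q'" by auto
  have "f / g = Fract (p * q') (q * p')"
    using * by (simp add: pos_poly_def)
  moreover have "pos_poly (p * q')" "pos_poly (q * p')"
    using * by (simp_all add: pos_poly_add pos_poly_mult)
  ultimately show ?case by (intro exI conjI)
qed

lemma subtraction_free_nonzero: "subtraction_free f \<Longrightarrow> f \<noteq> 0"
  using subtraction_free_pos[of f] by (auto simp: pos_poly_def Zero_fract_def eq_fract)

typedef (overloaded) 'v qsf = "{f :: 'v::linorder ratfun. subtraction_free f}"
  using subtraction_free.sf_one by blast

setup_lifting type_definition_qsf

instantiation qsf :: (linorder) semifield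
begin

lift_definition one_qsf :: "'a qsf" is 1 by (rule sf_one)
lift_definition times_qsf :: "'a qsf \<Rightarrow> 'a qsf \<Rightarrow> 'a qsf" is "(*)" by (rule sf_mult)
lift_definition inverse_qsf :: "'a qsf \<Rightarrow> 'a qsf" is inverse
  using sf_div[OF sf_one] by (simp add: field_simps)
lift_definition divide_qsf :: "'a qsf \<Rightarrow> 'a qsf \<Rightarrow> 'a qsf" is "(/)" by (rule sf_div)
lift_definition oplus_qsf :: "'a qsf \<Rightarrow> 'a qsf \<Rightarrow> 'a qsf" is "(+)" by (rule sf_add)

instance
proof
  fix a b c :: "'a qsf"
  show "a * b * c = a * (b * c)" by transfer (rule mult.assoc)
  show "a * b = b * a" by transfer (rule mult.commute)
  show "1 * a = a" by transfer (rule mult_1_left)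
  show "inverse a * a = 1" by transfer (rule left_inverse[OF subtraction_free_nonzero])
  show "a div b = a * inverse b" by transfer (rule divide_inverse)
  show "(a \<oplus> b) \<oplus> c = a \<oplus> (b \<oplus> c)" by transfer (rule add.assoc)
  show "a \<oplus> b = b \<oplus> a" by transfer (rule add.commute)
  show "a * (b \<oplus> c) = a * b \<oplus> a * c" by transfer (rule distrib_left)
qed

end

lift_definition qsf_var :: "'v::linorder \<Rightarrow> 'v qsf" is rf_var by (rule sf_var)

text \<open>\<open>sf_eval p f\<close> is \<open>f\<close> evaluated at \<open>p\<close> in the semifield \<open>'p\<close>, that is, the image of \<open>f\<close> under the
  unique semifield homomorphism sending each variable \<open>v\<close> to \<open>p v\<close>.\<close>

definition sf_eval :: "('v::linorder \<Rightarrow> 'p::semifield) \<Rightarrow> 'v qsf \<Rightarrow> 'p" where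
  "sf_eval p f = (THE h. semifield_hom h \<and> (\<forall>v. h (qsf_var v) = p v)) f"


section \<open>The tropical semifield\<close>

text \<open>A Laurent monomial is represented by its finitely supported vector of exponents.\<close>

typedef 'v trop = "UNIV :: ('v \<Rightarrow>\<^sub>0 int) set"
  morphisms trop_exponent Trop by simp

setup_lifting type_definition_trop

lift_definition pm_min :: "('v \<Rightarrow>\<^sub>0 int) \<Rightarrow> ('v \<Rightarrow>\<^sub>0 int) \<Rightarrow> ('v \<Rightarrow>\<^sub>0 int)"
  is "\<lambda>a b v. min (a v) (b v)"
proof -
  fix a b :: "'v \<Rightarrow> int"
  assume "finite {v. a v \<noteq> 0}" "finite {v. b v \<noteq> 0}"
  then have "finite ({v. a v \<noteq> 0} \<union> {v. b v \<noteq> 0})" by simp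
  then show "finite {v. min (a v) (b v) \<noteq> 0}"
    by (rule finite_subset[rotated]) (auto simp: min_def)
qed

instantiation trop :: (type) semifield
begin

lift_definition one_trop :: "'a trop" is 0 .
lift_definition times_trop :: "'a trop \<Rightarrow> 'a trop \<Rightarrow> 'a trop" is "(+)" .
lift_definition inverse_trop :: "'a trop \<Rightarrow> 'a trop" is uminus .
lift_definition divide_trop :: "'a trop \<Rightarrow> 'a trop \<Rightarrow> 'a trop" is "(-)" .
lift_definition oplus_trop :: "'a trop \<Rightarrow> 'a trop \<Rightarrow> 'a trop" is pm_min .

instance
  by (standard; transfer)
    (auto simp: poly_mapping_eq_iff fun_eq_iff lookup_add lookup_minus pm_min.rep_eq min_def)

end

lift_definition trop_var :: "'v \<Rightarrow> 'v trop" is "\<lambda>v. Poly_Mapping.single v 1" .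


section \<open>Generalized seeds\<close>

text \<open>Let \<open>\<iota>\<close> map a semifield \<open>\<P>\<close> to a field.  It is a group-ring embedding when it is multiplicative
  and its linear extension to the group ring \<open>\<int>\<P>\<close> (whose underlying group is the free abelian
  group \<open>'p \<Rightarrow>\<^sub>0 int\<close>) is injective; the field then contains copies of \<open>\<int>\<P>\<close> and \<open>\<rat>\<P>\<close>.\<close>

definition group_ring_map :: "('p \<Rightarrow> 'f::comm_ring_1) \<Rightarrow> ('p \<Rightarrow>\<^sub>0 int) \<Rightarrow> 'f" where
  "group_ring_map \<iota> a = (\<Sum>p\<in>Poly_Mapping.keys a. of_int (Poly_Mapping.lookup a p) * \<iota> p)"

definition group_ring_embedding :: "('p::semifield \<Rightarrow> 'f::field) \<Rightarrow> bool" where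
  "group_ring_embedding \<iota> \<longleftrightarrow>
     \<iota> 1 = 1 \<and> (\<forall>p q. \<iota> (p * q) = \<iota> p * \<iota> q) \<and> inj (group_ring_map \<iota>)"

definition QP :: "('p::semifield \<Rightarrow> 'f::field) \<Rightarrow> 'f set" where
  "QP \<iota> = {group_ring_map \<iota> a / group_ring_map \<iota> b | a b. group_ring_map \<iota> b \<noteq> 0}"

definition alg_independent :: "'f::field set \<Rightarrow> ('n \<Rightarrow> 'f) \<Rightarrow> bool" where
  "alg_independent K x \<longleftrightarrow>
     (\<forall>p :: ('n \<Rightarrow>\<^sub>0 nat) \<Rightarrow>\<^sub>0 'f.
        (\<forall>m. Poly_Mapping.lookup p m \<in> K) \<and> (\<Sum>m\<in>Poly_Mapping.keys p. Poly_Mapping.lookup p m * monom_eval x m) = 0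
        \<longrightarrow> p = 0)"

definition skew_symmetrizable :: "('n \<Rightarrow> 'n \<Rightarrow> int) \<Rightarrow> bool" where
  "skew_symmetrizable b \<longleftrightarrow>
     (\<exists>s :: 'n \<Rightarrow> int. (\<forall>i. s i > 0) \<and> (\<forall>i j. s i * b i j = - (s j * b j i)))"

text \<open>The polynomial \<open>Z\<^sub>i\<close> has degree \<open>degs S i\<close> and coefficients \<open>zcf S i s\<close> for
  \<open>s \<le> degs S i\<close>; other values of \<open>zcf S i\<close> are irrelevant.  The cluster variables are kept in a
  record extension because the mutation of the other data does not involve them.\<close>

record ('n, 'p) coeff_seed =
  yco :: "'n \<Rightarrow> 'p"
  bmat :: "'n \<Rightarrow> 'n \<Rightarrow> int"
  degs :: "'n \<Rightarrow> nat"
  zcf :: "'n \<Rightarrow> nat \<Rightarrow> 'p"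

record ('n, 'p, 'f) seed = "('n, 'p) coeff_seed" +
  xcl :: "'n \<Rightarrow> 'f"

text \<open>The field \<open>\<F> = \<rat>\<P>(x)\<close> of the seed is a subfield of the type \<open>'f\<close>, possibly a proper one.\<close>

definition generalized_seed :: "('p::semifield \<Rightarrow> 'f::field) \<Rightarrow> ('n::finite, 'p, 'f) seed \<Rightarrow> bool" where
  "generalized_seed \<iota> S \<longleftrightarrow>
     group_ring_embedding \<iota> \<and>
     alg_independent (QP \<iota>) (xcl S) \<and>
     skew_symmetrizable (bmat S) \<and>
     (\<forall>i. degs S i \<ge> 1 \<and> zcf S i 0 = 1 \<and> zcf S i (degs S i) = 1)"


section \<open>Mutation and patterns\<close>

abbreviation pos_part :: "int \<Rightarrow> int"  (\<open>[_]\<^sub>+\<close>) where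
  "[b]\<^sub>+ \<equiv> max b 0"

definition Z_at :: "('n, 'p::semifield, 'm) coeff_seed_scheme \<Rightarrow> 'n \<Rightarrow> 'p \<Rightarrow> 'p" where
  "Z_at S k y = osum (\<lambda>s. zcf S k s * y ^ s) (degs S k)"

definition mutate_coeff ::
  "'n \<Rightarrow> ('n, 'p::semifield, 'm) coeff_seed_scheme \<Rightarrow> ('n, 'p, 'm) coeff_seed_scheme" where
  "mutate_coeff k S = S\<lparr>
     yco := (\<lambda>j. if j = k then inverse (yco S k)
                 else yco S j * (yco S k ^ degs S k) powi [bmat S k j]\<^sub>+
                        * Z_at S k (yco S k) powi (- bmat S k j)),
     bmat := (\<lambda>i j. if i = k \<or> j = k then - bmat S i j
                    else bmat S i j + [bmat S i k]\<^sub>+ * int (degs S k) * bmat S k j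
                           + bmat S i k * int (degs S k) * [- bmat S k j]\<^sub>+),
     zcf := (\<lambda>i s. if i = k then zcf S k (degs S k - s) else zcf S i s)\<rparr>"

definition yhat :: "('p \<Rightarrow> 'f::field) \<Rightarrow> ('n::finite, 'p, 'f) seed \<Rightarrow> 'n \<Rightarrow> 'f" where
  "yhat \<iota> S k = \<iota> (yco S k) * (\<Prod>i\<in>UNIV. xcl S i powi bmat S i k)"

definition mutate ::
  "('p::semifield \<Rightarrow> 'f::field) \<Rightarrow> 'n::finite \<Rightarrow> ('n, 'p, 'f) seed \<Rightarrow> ('n, 'p, 'f) seed" where
  "mutate \<iota> k S = (mutate_coeff k S)\<lparr>
     xcl := (xcl S)(k :=
       (\<Prod>i\<in>UNIV. xcl S i powi [- bmat S i k]\<^sub>+) ^ degs S k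
         * ((\<Sum>s\<le>degs S k. \<iota> (zcf S k s) * yhat \<iota> S k ^ s) / \<iota> (Z_at S k (yco S k)))
         / xcl S k)\<rparr>"

text \<open>The vertices of the \<open>n\<close>-regular tree are the words in the edge labels without equal adjacent
  letters: the initial vertex is \<open>[]\<close>, and an edge labelled \<open>k\<close> joins \<open>w\<close> and \<open>k # w\<close>.  So \<open>w\<close>, read
  from right to left, lists the labels on the path from the initial vertex to \<open>w\<close>, and the
  seed at \<open>w\<close> is obtained by mutating along this path.\<close>

definition tree_vertices :: "'n list set" where
  "tree_vertices = {w. distinct_adj w}"

primrec coeff_pattern ::
  "('n, 'p::semifield, 'm) coeff_seed_scheme \<Rightarrow> 'n list \<Rightarrow> ('n, 'p, 'm) coeff_seed_scheme" where
  "coeff_pattern S [] = S"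
| "coeff_pattern S (k # w) = mutate_coeff k (coeff_pattern S w)"

primrec cluster_pattern ::
  "('p::semifield \<Rightarrow> 'f::field) \<Rightarrow> ('n::finite, 'p, 'f) seed \<Rightarrow> 'n list \<Rightarrow> ('n, 'p, 'f) seed" where
  "cluster_pattern \<iota> S [] = S"
| "cluster_pattern \<iota> S (k # w) = mutate \<iota> k (cluster_pattern \<iota> S w)"

definition ordinary_seed ::
  "('n \<Rightarrow> 'f) \<Rightarrow> ('n \<Rightarrow> 'p) \<Rightarrow> ('n \<Rightarrow> 'n \<Rightarrow> int) \<Rightarrow> ('n, 'p::semifield, 'f) seed" where
  "ordinary_seed x y b =
     \<lparr>yco = y, bmat = b, degs = (\<lambda>_. 1), zcf = (\<lambda>_ _. 1), xcl = x\<rparr>"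


section \<open>c-vectors, g-vectors and F-polynomials\<close>

text \<open>Of the variables \<open>Zv i s\<close> only those with \<open>0 < s < d\<^sub>i\<close> are used.\<close>

datatype 'n yzvar = Yv 'n | Zv 'n nat
datatype 'n xyzvar = Xv 'n | Cv "'n yzvar"

primrec yzkey :: "'n yzvar \<Rightarrow> 'n \<times> nat" where
  "yzkey (Yv i) = (i, 0)"
| "yzkey (Zv i s) = (i, Suc s)"

primrec xyzkey :: "'n xyzvar \<Rightarrow> 'n \<times> nat" where
  "xyzkey (Xv i) = (i, 0)"
| "xyzkey (Cv v) = (fst (yzkey v), Suc (snd (yzkey v)))"

lemma yzkey_inj: "yzkey a = yzkey b \<Longrightarrow> a = b"
  by (cases a; cases b) auto

lemma xyzkey_inj: "xyzkey a = xyzkey b \<Longrightarrow> a = b"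
  by (cases a; cases b) (auto intro: yzkey_inj prod_eqI)

instantiation yzvar :: (linorder) linorder
begin
definition "a \<le> b \<longleftrightarrow> yzkey a \<le> yzkey b"
definition "a < b \<longleftrightarrow> yzkey a < yzkey b"
instance
proof
  fix a b c :: "'a yzvar"
  show "(a < b) = (a \<le> b \<and> \<not> b \<le> a)" unfolding less_eq_yzvar_def less_yzvar_def by (rule less_le_not_le)
  show "a \<le> a" unfolding less_eq_yzvar_def by (rule order_refl)
  show "a \<le> b \<Longrightarrow> b \<le> c \<Longrightarrow> a \<le> c" unfolding less_eq_yzvar_def by (rule order_trans)
  show "a \<le> b \<Longrightarrow> b \<le> a \<Longrightarrow> a = b" unfolding less_eq_yzvar_def by (intro yzkey_inj order_antisym)
  show "a \<le> b \<or> b \<le> a" unfolding less_eq_yzvar_def by (rule linear)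
qed
end

instantiation xyzvar :: (linorder) linorder
begin
definition "a \<le> b \<longleftrightarrow> xyzkey a \<le> xyzkey b"
definition "a < b \<longleftrightarrow> xyzkey a < xyzkey b"
instance
proof
  fix a b c :: "'a xyzvar"
  show "(a < b) = (a \<le> b \<and> \<not> b \<le> a)" unfolding less_eq_xyzvar_def less_xyzvar_def by (rule less_le_not_le)
  show "a \<le> a" unfolding less_eq_xyzvar_def by (rule order_refl)
  show "a \<le> b \<Longrightarrow> b \<le> c \<Longrightarrow> a \<le> c" unfolding less_eq_xyzvar_def by (rule order_trans)
  show "a \<le> b \<Longrightarrow> b \<le> a \<Longrightarrow> a = b" unfolding less_eq_xyzvar_def by (intro xyzkey_inj order_antisym)
  show "a \<le> b \<or> b \<le> a" unfolding less_eq_xyzvar_def by (rule linear)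
qed
end

definition universal_z :: "('n yzvar \<Rightarrow> 'p::semifield) \<Rightarrow> ('n \<Rightarrow> nat) \<Rightarrow> 'n \<Rightarrow> nat \<Rightarrow> 'p" where
  "universal_z u d i s = (if 0 < s \<and> s < d i then u (Zv i s) else 1)"

definition Y_function ::
  "('n::linorder \<Rightarrow> 'n \<Rightarrow> int) \<Rightarrow> ('n \<Rightarrow> nat) \<Rightarrow> 'n list \<Rightarrow> 'n \<Rightarrow> 'n yzvar qsf" where
  "Y_function b d t =
     yco (coeff_pattern
       \<lparr>yco = (\<lambda>i. qsf_var (Yv i)), bmat = b, degs = d, zcf = universal_z qsf_var d\<rparr> t)"

text \<open>\<open>c_entry b d t i j\<close> is \<open>c\<^sup>t\<^sub>i\<^sub>j\<close>.\<close>

definition c_entry ::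
  "('n::linorder \<Rightarrow> 'n \<Rightarrow> int) \<Rightarrow> ('n \<Rightarrow> nat) \<Rightarrow> 'n list \<Rightarrow> 'n \<Rightarrow> 'n \<Rightarrow> int" where
  "c_entry b d t i j = Poly_Mapping.lookup (trop_exponent (sf_eval trop_var (Y_function b d t j))) (Yv i)"

definition trop_to_ratfun :: "'n::linorder yzvar trop \<Rightarrow> 'n xyzvar ratfun" where
  "trop_to_ratfun a =
     (\<Prod>v\<in>Poly_Mapping.keys (trop_exponent a). rf_var (Cv v) powi Poly_Mapping.lookup (trop_exponent a) v)"

definition X_function ::
  "('n::{finite,linorder} \<Rightarrow> 'n \<Rightarrow> int) \<Rightarrow> ('n \<Rightarrow> nat) \<Rightarrow> 'n list \<Rightarrow> 'n \<Rightarrow> 'n xyzvar ratfun" where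
  "X_function b d t =
     xcl (cluster_pattern trop_to_ratfun
       \<lparr>yco = (\<lambda>i. trop_var (Yv i)), bmat = b, degs = d, zcf = universal_z trop_var d,
        xcl = (\<lambda>i. rf_var (Xv i))\<rparr> t)"

text \<open>The grading by \<open>deg x\<^sub>i = e\<^sub>i\<close>, \<open>deg y\<^sub>j = - (j-th column of b)\<close>, \<open>deg z\<^sub>i\<^sub>,\<^sub>s = 0\<close>.  A quotient of
  homogeneous polynomials is homogeneous, of degree the difference of the degrees; on
  Laurent polynomials in \<open>x\<close> this is the usual notion of homogeneity and degree.\<close>

primrec yz_degree :: "('n \<Rightarrow> 'n \<Rightarrow> int) \<Rightarrow> 'n yzvar \<Rightarrow> 'n \<Rightarrow> int" where
  "yz_degree b (Yv j) = (\<lambda>i. - b i j)"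
| "yz_degree b (Zv j s) = (\<lambda>i. 0)"

primrec var_degree :: "('n \<Rightarrow> 'n \<Rightarrow> int) \<Rightarrow> 'n xyzvar \<Rightarrow> 'n \<Rightarrow> int" where
  "var_degree b (Xv j) = (\<lambda>i. if i = j then 1 else 0)"
| "var_degree b (Cv v) = yz_degree b v"

definition monom_degree :: "('n \<Rightarrow> 'n \<Rightarrow> int) \<Rightarrow> ('n xyzvar \<Rightarrow>\<^sub>0 nat) \<Rightarrow> 'n \<Rightarrow> int" where
  "monom_degree b m i = (\<Sum>v\<in>Poly_Mapping.keys m. int (Poly_Mapping.lookup m v) * var_degree b v i)"

definition homogeneous_poly :: "('n \<Rightarrow> 'n \<Rightarrow> int) \<Rightarrow> ('n \<Rightarrow> int) \<Rightarrow> 'n xyzvar mpoly \<Rightarrow> bool" where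
  "homogeneous_poly b g p \<longleftrightarrow> (\<forall>m\<in>Poly_Mapping.keys p. monom_degree b m = g)"

definition homogeneous ::
  "('n::linorder \<Rightarrow> 'n \<Rightarrow> int) \<Rightarrow> ('n \<Rightarrow> int) \<Rightarrow> 'n xyzvar ratfun \<Rightarrow> bool" where
  "homogeneous b g f \<longleftrightarrow>
     (\<exists>p q g1 g2. q \<noteq> 0 \<and> f = Fract p q \<and> homogeneous_poly b g1 p \<and> homogeneous_poly b g2 q
        \<and> (\<forall>i. g i = g1 i - g2 i))"

text \<open>\<open>g_entry b d t i j\<close> is \<open>g\<^sup>t\<^sub>i\<^sub>j\<close>.\<close>

definition g_entry ::
  "('n::{finite,linorder} \<Rightarrow> 'n \<Rightarrow> int) \<Rightarrow> ('n \<Rightarrow> nat) \<Rightarrow> 'n list \<Rightarrow> 'n \<Rightarrow> 'n \<Rightarrow> int" where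
  "g_entry b d t i j = (THE g. homogeneous b g (X_function b d t j)) i"

text \<open>\<open>F_polynomial b d t j\<close> is the element of \<open>\<rat>(y, z)\<close> obtained from \<open>X\<^sup>t\<^sub>j\<close> by setting every
  \<open>x\<^sub>i\<close> to \<open>1\<close>.  That it lies in \<open>\<int>[y, z]\<close> is the Laurent phenomenon and not part of the definition.\<close>

primrec x_to_one :: "'n::linorder xyzvar \<Rightarrow> 'n yzvar ratfun" where
  "x_to_one (Xv i) = 1"
| "x_to_one (Cv v) = rf_var v"

definition F_polynomial ::
  "('n::{finite,linorder} \<Rightarrow> 'n \<Rightarrow> int) \<Rightarrow> ('n \<Rightarrow> nat) \<Rightarrow> 'n list \<Rightarrow> 'n \<Rightarrow> 'n yzvar ratfun" where
  "F_polynomial b d t j = rf_eval x_to_one (X_function b d t j)"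


section \<open>Specialization at binomial coefficients\<close>

primrec bin_point :: "('n \<Rightarrow> nat) \<Rightarrow> ('n \<Rightarrow> 'f::semiring_1) \<Rightarrow> 'n yzvar \<Rightarrow> 'f" where
  "bin_point d y (Yv i) = y i"
| "bin_point d y (Zv i s) = of_nat (d i choose s)"

text \<open>\<open>F_bin_sf b d t j\<close> is \<open>F\<^sup>t\<^sub>j(\<cdot>, z\<^sup>b\<^sup>i\<^sup>n)\<close> as an element of \<open>\<rat>\<^sub>s\<^sub>f(y\<^sub>1, \<dots>, y\<^sub>n)\<close>.\<close>

definition F_bin_sf ::
  "('n::{finite,linorder} \<Rightarrow> 'n \<Rightarrow> int) \<Rightarrow> ('n \<Rightarrow> nat) \<Rightarrow> 'n list \<Rightarrow> 'n \<Rightarrow> 'n qsf" where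
  "F_bin_sf b d t j = Abs_qsf (rf_eval (bin_point d rf_var) (F_polynomial b d t j))"

definition F_bin_P ::
  "('n::{finite,linorder}, 'p::semifield, 'm) coeff_seed_scheme \<Rightarrow> 'n list \<Rightarrow> 'n \<Rightarrow> 'p" where
  "F_bin_P S t j = sf_eval (yco S) (F_bin_sf (bmat S) (degs S) t j)"

text \<open>The elements \<open>x\<^sup>t\<^sub>j\<close> and \<open>y\<^sup>t\<^sub>j\<close> at \<open>z = z\<^sup>b\<^sup>i\<^sup>n\<close>, for the pattern with initial seed \<open>S\<close>.\<close>

definition x_bin ::
  "('p::semifield \<Rightarrow> 'f::field) \<Rightarrow> ('n::{finite,linorder}, 'p, 'f) seed \<Rightarrow> 'n list \<Rightarrow> 'n \<Rightarrow> 'f" where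
  "x_bin \<iota> S t j =
     (\<Prod>i\<in>UNIV. xcl S i powi g_entry (bmat S) (degs S) t i j)
       * (rf_eval (bin_point (degs S) (yhat \<iota> S)) (F_polynomial (bmat S) (degs S) t j)
          / \<iota> (F_bin_P S t j))"

definition y_bin ::
  "('n::{finite,linorder}, 'p::semifield, 'm) coeff_seed_scheme \<Rightarrow> 'n list \<Rightarrow> 'n \<Rightarrow> 'p" where
  "y_bin S t j =
     (\<Prod>i\<in>UNIV. yco S i powi c_entry (bmat S) (degs S) t i j)
       * (\<Prod>i\<in>UNIV. F_bin_P S t i powi bmat (coeff_pattern S t) i j)"

text \<open>The pattern of the left companion, with initial seed \<open>(r, y, D B)\<close>, where \<open>r\<close> stands for the
  cluster of roots \<open>x\<^sub>i\<^sup>1\<^sup>/\<^sup>d\<^sup>i\<close>.\<close>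

definition left_companion ::
  "('p::semifield \<Rightarrow> 'f::field) \<Rightarrow> ('n::finite, 'p, 'f) seed \<Rightarrow> ('n \<Rightarrow> 'f) \<Rightarrow> 'n list
     \<Rightarrow> ('n, 'p, 'f) seed" where
  "left_companion \<iota> S r =
     cluster_pattern \<iota> (ordinary_seed r (yco S) (\<lambda>i j. int (degs S i) * bmat S i j))"

end

theory Submission
  imports Defs
begin

text \<open>
By induction along the tree, \<open>X\<close>-functions are subtraction-free and homogeneous, and since
  \<open>G\<^sup>t B\<^sup>t = B C\<^sup>t\<close>, the element \<open>y\<^sub>k \<Prod>\<^sub>i x\<^sub>i\<^bsup>b\<^sub>i\<^sub>k\<^esup>\<close> of every seed has degree \<open>0\<close>.  Putting \<open>x = 1\<close> turns
  the mutation rule into a recursion for \<open>F\<close>-polynomials, and at \<open>z = z\<^sup>b\<^sup>i\<^sup>n\<close> the polynomial \<open>Z\<^sub>k(u)\<close>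
  becomes \<open>(1 + u)\<^bsup>d\<^sub>k\<^esup>\<close>, whether or not it has been reversed.  Subtraction-free expressions can be
  evaluated at positive points without vanishing denominators; this applies to \<open>\<P>\<close>, and
  to the field, where algebraic independence of \<open>x\<close> over \<open>\<rat>\<P>\<close> keeps \<open>0\<close> out of the positive
  cone.  The recursions so obtained for \<open>x\<close> and \<open>y\<close> at \<open>z = z\<^sup>b\<^sup>i\<^sup>n\<close> are those of the \<open>d\<^sub>i\<close>-th powers of
  the cluster variables and of the coefficients in the left companion.
\<close>

section \<open>Monomials in commutative groups\<close>

text \<open>The elements \<open>x_bin\<close> and \<open>y_bin\<close> are given by separation
  formulas, not by mutation, so the main task is to show that they mutate. In the recursion for
  F-polynomials the value of Z_k is divided by its tropical value, a Laurent monomial in the y_i,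
  which does not occur in the mutation rules to be proved. For \<open>y_bin\<close> it is absorbed
  by the term with \<open>[- c]_+\<close> of the c-vector recursion. For \<open>x_bin\<close> it is
  evaluated at yhat and so has a y-part and an x-part: the y-part occurs in both F(yhat) and F|_P(y)
  and cancels in their quotient, and the x-part cancels the last sum of the g-vector recursion. A
  second obstacle is that \<open>rf_eval\<close> says nothing where denominators vanish, while the
  ambient field carries no order. Positivity is therefore expressed by cones, that is, sets that
  contain 1, miss 0 and are closed under sum, product and quotient. One and the same recursion step
  is then transported along three maps: setting x = 1, setting z to binomial coefficients, and
  evaluating in P.\<close>

text \<open>A common superclass of fields and semifields, so that Laurent monomials are treated only once.\<close>

class inv_monoid = comm_monoid_mult + inverse +
  assumes inverse_equality: "a * b = 1 \<Longrightarrow> inverse a = b"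
    and divide_eq_times_inverse: "a / b = a * inverse b"

subclass (in semifield) inv_monoid
proof
  fix a b :: 'a
  assume "a * b = 1"
  then have "inverse a * (a * b) = inverse a" by simp
  then show "inverse a = b" by (simp add: sf_left_inverse flip: mult.assoc)
qed (rule sf_divide)

subclass (in field) inv_monoid
  by standard (auto intro: inverse_unique simp: divide_inverse)

text \<open>True everywhere in a semifield, and away from \<open>0\<close> in a field. The class
  says nothing about \<open>inverse\<close> at other elements, so exponent laws such as
  \<open>invertible_powi_add\<close> carry this hypothesis.\<close>

definition invertible :: "'a::inv_monoid \<Rightarrow> bool" where
  "invertible a \<longleftrightarrow> a * inverse a = 1"

lemma invertibleI: "a * b = 1 \<Longrightarrow> invertible (a::'a::inv_monoid)"
  using inverse_equality by (auto simp: invertible_def)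

lemma invertible_semifield [simp]: "invertible (a::'a::semifield)"
  by (simp add: invertible_def mult.commute[of a] sf_left_inverse)

lemma invertible_field [simp]: "invertible (a::'a::field) \<longleftrightarrow> a \<noteq> 0"
  by (auto simp: invertible_def)

lemma invertible_one [simp]: "invertible 1"
  by (rule invertibleI[of _ 1]) simp

lemma invertible_mult [intro]:
  assumes "invertible a" "invertible b"
  shows "invertible (a * b)" and "inverse (a * b) = inverse a * inverse b"
proof -
  have "a * b * (inverse a * inverse b) = (a * inverse a) * (b * inverse b)" by (simp only: ac_simps)
  then have *: "a * b * (inverse a * inverse b) = 1" using assms by (simp add: invertible_def)
  show "invertible (a * b)" using * by (rule invertibleI)
  show "inverse (a * b) = inverse a * inverse b" using * by (rule inverse_equality)
qed

lemma invertible_inverse [intro]: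
  assumes "invertible a"
  shows "invertible (inverse a)" and "inverse (inverse a) = a"
proof -
  have *: "inverse a * a = 1" using assms by (simp add: invertible_def mult.commute)
  show "invertible (inverse a)" using * by (rule invertibleI)
  show "inverse (inverse a) = a" using * by (rule inverse_equality)
qed

lemma invertible_cancel_left: "invertible a \<Longrightarrow> a * b = a * c \<Longrightarrow> b = c"
proof -
  assume *: "invertible a" "a * b = a * c"
  then have "inverse a * (a * b) = inverse a * (a * c)" by simp
  moreover have "inverse a * (a * x) = x" for x
    using *(1) by (simp add: invertible_def mult.commute[of "inverse a"] flip: mult.assoc)
  ultimately show "b = c" by simp
qed

lemma inverse_one [simp]: "inverse (1::'a::inv_monoid) = 1"
  by (rule inverse_equality) simp

lemma invertible_power:
  assumes "invertible a"
  shows "invertible (a ^ n)" and "inverse (a ^ n) = inverse a ^ n"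
proof -
  have "a ^ n * inverse a ^ n = 1"
    using assms by (simp add: invertible_def flip: power_mult_distrib)
  then show "invertible (a ^ n)" "inverse (a ^ n) = inverse a ^ n"
    by (auto intro: invertibleI inverse_equality)
qed

lemma invertible_powi: "invertible a \<Longrightarrow> invertible (a powi n)"
  by (auto simp: power_int_def invertible_power invertible_inverse)

lemma invertible_powi_add:
  assumes "invertible a"
  shows "a powi (m + n) = a powi m * a powi n"
proof -
  have cancel: "a ^ (p + q) * inverse a ^ q = a ^ p" for p q
  proof -
    have "a ^ (p + q) * inverse a ^ q = a ^ p * (a ^ q * inverse a ^ q)"
      by (simp add: power_add mult.assoc)
    then show ?thesis using assms by (simp add: invertible_def flip: power_mult_distrib)
  qed
  have cancel': "inverse a ^ (p + q) * a ^ q = inverse a ^ p" for p q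
  proof -
    have "inverse a ^ (p + q) * a ^ q = inverse a ^ p * (a ^ q * inverse a ^ q)"
      by (simp add: power_add ac_simps)
    then show ?thesis using assms by (simp add: invertible_def flip: power_mult_distrib)
  qed
  \<comment> \<open>Every integer is a difference of naturals, and
    \<open>a ^ p * inverse a ^ q\<close> depends only on that difference. Signs are thus treated
    once, and not separately for \<open>m\<close>, \<open>n\<close> and
    \<open>m + n\<close>.\<close>
  have mixed: "a powi (int p - int q) = a ^ p * inverse a ^ q" for p q
  proof (cases "q \<le> p")
    case True
    then obtain r where "p = r + q" by (metis le_Suc_ex add.commute)
    then show ?thesis by (simp add: cancel)
  next
    case False
    then obtain r where "q = r + p" "r > 0" by (metis le_Suc_ex add.commute nat_le_linear not_gr_zero add_0)
    then show ?thesis using cancel'[of r p] by (simp add: power_int_def mult.commute)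
  qed
  obtain p q where m: "m = int p - int q" by (metis int_diff_cases)
  obtain p' q' where n: "n = int p' - int q'" by (metis int_diff_cases)
  have "m + n = int (p + p') - int (q + q')" using m n by simp
  then show ?thesis unfolding m n
    by (metis mixed power_add mult.assoc mult.left_commute)
qed

lemma inverse_powi: "invertible a \<Longrightarrow> inverse (a powi n) = a powi (- n)"
  by (rule inverse_equality) (simp flip: invertible_powi_add)

lemma one_powi [simp]: "(1::'a::inv_monoid) powi n = 1"
  by (simp add: power_int_def)

lemma mult_powi:
  "invertible a \<Longrightarrow> invertible b \<Longrightarrow> (a * b) powi n = a powi n * b powi n"
  by (simp add: power_int_def invertible_mult power_mult_distrib)

lemma powi_mult:
  assumes "invertible a"
  shows "a powi (m * n) = (a powi m) powi n"
proof -
  have *: "a powi (m * int k) = (a powi m) ^ k" for k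
    by (induction k) (simp_all add: distrib_left invertible_powi_add[OF assms])
  show ?thesis
  proof (cases n rule: int_cases2)
    case (nonneg k)
    then show ?thesis by (simp add: *)
  next
    case (nonpos k)
    have "a powi (m * n) = inverse (a powi (m * int k))"
      using nonpos by (simp add: inverse_powi[OF assms])
    also have "\<dots> = (a powi m) powi n"
      unfolding * using inverse_powi[OF invertible_powi[OF assms], of m "int k"] nonpos by simp
    finally show ?thesis .
  qed
qed

definition monomial :: "('i::finite \<Rightarrow> 'a::inv_monoid) \<Rightarrow> ('i \<Rightarrow> int) \<Rightarrow> 'a" where
  "monomial u e = (\<Prod>i\<in>UNIV. u i powi e i)"

lemma invertible_prod:
  "(\<And>i. i \<in> A \<Longrightarrow> invertible (u i)) \<Longrightarrow> invertible (\<Prod>i\<in>A. u i)"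
  by (induction A rule: infinite_finite_induct) auto

lemma invertible_monomial: "(\<And>i. invertible (u i)) \<Longrightarrow> invertible (monomial u e)"
  unfolding monomial_def by (intro invertible_prod invertible_powi)

lemma monomial_add:
  "(\<And>i. invertible (u i)) \<Longrightarrow> monomial u (\<lambda>i. e i + e' i) = monomial u e * monomial u e'"
  by (simp add: monomial_def invertible_powi_add prod.distrib)

lemma monomial_zero [simp]: "monomial u (\<lambda>i. 0) = 1"
  by (simp add: monomial_def)

lemma monomial_scale:
  assumes "\<And>i. invertible (u i)"
  shows "monomial u (\<lambda>i. e i * n) = monomial u e powi n"
proof -
  have "(\<Prod>i\<in>A. u i powi (e i * n)) = (\<Prod>i\<in>A. u i powi e i) powi n" if "finite A" for A
    using that
    by induction (simp_all add: powi_mult mult_powi assms invertible_powi invertible_prod)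
  then show ?thesis by (simp add: monomial_def)
qed

lemma monomial_mult_base:
  assumes "\<And>i. invertible (u i)" "\<And>i. invertible (v i)"
  shows "monomial (\<lambda>i. u i * v i) e = monomial u e * monomial v e"
  by (simp add: monomial_def mult_powi assms prod.distrib)

lemma monomial_unit: "monomial u (\<lambda>i. if i = k then n else 0) = u k powi n"
  by (simp add: monomial_def if_distrib[where f = "\<lambda>e. _ powi e"] cong: if_cong)

lemma monomial_prod_exponent:
  assumes "\<And>i. invertible (u i)" "finite A"
  shows "monomial u (\<lambda>i. \<Sum>j\<in>A. e i j) = (\<Prod>j\<in>A. monomial u (\<lambda>i. e i j))"
  using assms(2) by induction (simp_all add: monomial_add assms(1))

text \<open>Composition of monomial maps is multiplication of exponent matrices. The matrix products
  in the x-exponents of \<open>monomial_x_bin\<close> and \<open>monomial_yhat\<close> arise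
  here.\<close>

lemma monomial_compose:
  assumes "\<And>i. invertible (u i)"
  shows "monomial (\<lambda>j. monomial u (\<lambda>i. a i j)) e = monomial u (\<lambda>i. \<Sum>j\<in>UNIV. a i j * e j)"
  unfolding monomial_def[of "\<lambda>j. monomial u (\<lambda>i. a i j)"]
  by (simp add: monomial_prod_exponent monomial_scale assms)

lemma monomial_update:
  "e k = 0 \<Longrightarrow> monomial (u(k := v)) e = monomial u e"
  unfolding monomial_def by (rule prod.cong) auto

lemma monomial_update':
  assumes "\<And>i. invertible (u i)" "invertible v"
  shows "monomial (u(k := v)) e = monomial u (e(k := 0)) * v powi e k"
proof -
  have "monomial (u(k := v)) e = monomial (u(k := v)) (\<lambda>i. (e(k := 0)) i + (if i = k then e k else 0))"
    by (rule arg_cong[where f = "monomial _"]) auto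
  also have "\<dots> = monomial (u(k := v)) (e(k := 0)) * monomial (u(k := v)) (\<lambda>i. if i = k then e k else 0)"
    by (rule monomial_add) (auto simp: assms)
  finally show ?thesis by (simp add: monomial_unit monomial_update)
qed

section \<open>Evaluation of rational functions on positive cones\<close>

lemma poly_mapping_sum_single:
  fixes p :: "'m \<Rightarrow>\<^sub>0 'c::comm_monoid_add"
  shows "p = (\<Sum>m\<in>Poly_Mapping.keys p. Poly_Mapping.single m (Poly_Mapping.lookup p m))"
  by (rule poly_mapping_eqI)
    (simp add: lookup_sum lookup_single when_def sum.delta' in_keys_iff)

text \<open>\<open>\<phi> m c\<close> stands for the value of the term with monomial
  \<open>m\<close> and coefficient \<open>c\<close>. The predicate \<open>C\<close> lets one proof
  serve two evaluations: into a ring, with arbitrary integer coefficients, and into a semiring,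
  where coefficients pass through \<open>nat\<close>, which respects sums and products of
  nonnegative integers but not of all integers.\<close>

lemma sum_keys_mult:
  fixes \<phi> :: "'m::comm_monoid_add \<Rightarrow> 'c::comm_semiring_0 \<Rightarrow> 'd::comm_semiring_0"
  assumes C: "C 0" "\<And>a b. C a \<Longrightarrow> C b \<Longrightarrow> C (a + b)" "\<And>a b. C a \<Longrightarrow> C b \<Longrightarrow> C (a * b)"
    and zero: "\<And>m. \<phi> m 0 = 0"
    and add: "\<And>m a b. C a \<Longrightarrow> C b \<Longrightarrow> \<phi> m (a + b) = \<phi> m a + \<phi> m b"
    and mult: "\<And>m n a b. C a \<Longrightarrow> C b \<Longrightarrow> \<phi> (m + n) (a * b) = \<phi> m a * \<phi> n b"
  defines "E \<equiv> \<lambda>p. \<Sum>m\<in>Poly_Mapping.keys p. \<phi> m (Poly_Mapping.lookup p m)"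
  assumes p: "\<And>m. C (Poly_Mapping.lookup p m)" and q: "\<And>m. C (Poly_Mapping.lookup q m)"
  shows "E (p * q) = E p * E q"
proof -
  let ?C = "\<lambda>p. \<forall>m. C (Poly_Mapping.lookup p m)"
  have single: "E (Poly_Mapping.single m a) = \<phi> m a" for m a
    by (cases "a = 0") (simp_all add: E_def zero)
  have plus: "E (p + q) = E p + E q" if "?C p" "?C q" for p q
    unfolding E_def using that by (intro setsum_keys_plus_distrib zero add) auto
  have Csum: "?C (\<Sum>i\<in>I. f i)" if "\<And>i. i \<in> I \<Longrightarrow> ?C (f i)" for I and f :: "'i \<Rightarrow> 'm \<Rightarrow>\<^sub>0 'c"
    using that by (induction I rule: infinite_finite_induct) (auto simp: C lookup_add)
  have Esum: "E (\<Sum>i\<in>I. f i) = (\<Sum>i\<in>I. E (f i))" if "\<And>i. i \<in> I \<Longrightarrow> ?C (f i)"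
    for I and f :: "'i \<Rightarrow> 'm \<Rightarrow>\<^sub>0 'c"
    using that
  proof (induction I rule: infinite_finite_induct)
    case (insert i I)
    have "E (f i + sum f I) = E (f i) + E (sum f I)"
      using insert.prems by (intro plus Csum) auto
    then show ?case using insert by simp
  qed (simp_all add: E_def)
  have Csingle: "?C (Poly_Mapping.single m a)" if "C a" for m a
    using that C(1) by (auto simp: lookup_single when_def)
  let ?lp = "Poly_Mapping.lookup p" and ?lq = "Poly_Mapping.lookup q"
  have "p * q = (\<Sum>m\<in>Poly_Mapping.keys p. Poly_Mapping.single m (?lp m))
      * (\<Sum>n\<in>Poly_Mapping.keys q. Poly_Mapping.single n (?lq n))"
    using poly_mapping_sum_single[of p] poly_mapping_sum_single[of q] by simp
  also have "\<dots> = (\<Sum>m\<in>Poly_Mapping.keys p. \<Sum>n\<in>Poly_Mapping.keys q.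
      Poly_Mapping.single (m + n) (?lp m * ?lq n))"
    by (simp add: sum_product mult_single)
  also have "E \<dots> = (\<Sum>m\<in>Poly_Mapping.keys p. \<Sum>n\<in>Poly_Mapping.keys q. \<phi> m (?lp m) * \<phi> n (?lq n))"
    by (subst Esum, intro Csum Csingle C p q, rule sum.cong[OF refl],
        subst Esum, intro Csingle C p q, simp add: single mult p q)
  also have "\<dots> = E p * E q"
    unfolding E_def by (simp add: sum_product)
  finally show ?thesis .
qed

section \<open>Evaluation of polynomials and of quotients of polynomials\<close>

lemma monom_eval_superset:
  assumes "finite A" "Poly_Mapping.keys m \<subseteq> A"
  shows "monom_eval \<sigma> m = (\<Prod>v\<in>A. \<sigma> v ^ Poly_Mapping.lookup m v)"
  unfolding monom_eval_def using assms
  by (intro prod.mono_neutral_left) (auto simp: in_keys_iff)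

lemma monom_eval_add: "monom_eval \<sigma> (m + n) = monom_eval \<sigma> m * monom_eval \<sigma> n"
proof -
  let ?A = "Poly_Mapping.keys m \<union> Poly_Mapping.keys n"
  have "Poly_Mapping.keys (m + n) \<subseteq> ?A" by (rule keys_add)
  then show ?thesis
    by (simp add: monom_eval_superset[where A = ?A] lookup_add power_add prod.distrib)
qed

lemma monom_eval_zero [simp]: "monom_eval \<sigma> 0 = 1"
  by (simp add: monom_eval_def)

lemma monom_eval_single [simp]: "monom_eval \<sigma> (Poly_Mapping.single v n) = \<sigma> v ^ n"
  by (cases "n = 0") (simp_all add: monom_eval_def)

lemma mpoly_eval_add: "mpoly_eval \<sigma> (p + q) = mpoly_eval \<sigma> p + mpoly_eval \<sigma> q"
  unfolding mpoly_eval_def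
  by (rule setsum_keys_plus_distrib) (simp_all add: algebra_simps)

lemma mpoly_eval_mult: "mpoly_eval \<sigma> (p * q) = mpoly_eval \<sigma> p * mpoly_eval \<sigma> q"
  unfolding mpoly_eval_def
  by (rule sum_keys_mult[where C = "\<lambda>_. True"]) (simp_all add: algebra_simps monom_eval_add)

lemma mpoly_eval_zero [simp]: "mpoly_eval \<sigma> 0 = 0"
  by (simp add: mpoly_eval_def)

lemma mpoly_eval_single [simp]:
  "mpoly_eval \<sigma> (Poly_Mapping.single m c) = of_int c * monom_eval \<sigma> m"
  by (cases "c = 0") (simp_all add: mpoly_eval_def)

lemma mpoly_eval_one [simp]: "mpoly_eval \<sigma> 1 = 1"
  using mpoly_eval_single[of \<sigma> 0 1] by simp

text \<open>Two representations cross-multiply to an identity of polynomials. Evaluating it and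
  dividing by the two nonvanishing denominators gives equal values, so the definite description is
  legitimate.\<close>

lemma rf_eval_Fract:
  fixes \<sigma> :: "'v::linorder \<Rightarrow> 'f::field"
  assumes q: "mpoly_eval \<sigma> q \<noteq> 0"
  shows "rf_eval \<sigma> (Fract p q) = mpoly_eval \<sigma> p / mpoly_eval \<sigma> q"
  unfolding rf_eval_def
proof (rule the_equality)
  fix r
  assume "\<exists>p' q'. Fract p q = Fract p' q' \<and> mpoly_eval \<sigma> q' \<noteq> 0 \<and> r = mpoly_eval \<sigma> p' / mpoly_eval \<sigma> q'"
  then obtain p' q' where *: "Fract p q = Fract p' q'" "mpoly_eval \<sigma> q' \<noteq> 0"
    "r = mpoly_eval \<sigma> p' / mpoly_eval \<sigma> q'" by blast
  have "q \<noteq> 0" "q' \<noteq> 0" using q *(2) by auto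
  then have "p * q' = p' * q" using *(1) by (simp add: eq_fract)
  then have "mpoly_eval \<sigma> p * mpoly_eval \<sigma> q' = mpoly_eval \<sigma> p' * mpoly_eval \<sigma> q"
    by (metis mpoly_eval_mult)
  then show "r = mpoly_eval \<sigma> p / mpoly_eval \<sigma> q"
    by (simp add: *(3) frac_eq_eq[OF *(2) q])
qed (use q in blast)

text \<open>A substitute for the positive elements of a field that need not be ordered. Membership
  certifies that an element may be used as a denominator.\<close>

definition cone :: "'a::field set \<Rightarrow> bool" where
  "cone K \<longleftrightarrow> 1 \<in> K \<and> 0 \<notin> K \<and> (\<forall>a\<in>K. \<forall>b\<in>K. a + b \<in> K \<and> a * b \<in> K \<and> a / b \<in> K)"

lemma cone_mem:
  assumes "cone K"
  shows "1 \<in> K" "a \<in> K \<Longrightarrow> b \<in> K \<Longrightarrow> a + b \<in> K" "a \<in> K \<Longrightarrow> b \<in> K \<Longrightarrow> a * b \<in> K"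
    "a \<in> K \<Longrightarrow> b \<in> K \<Longrightarrow> a / b \<in> K" "a \<in> K \<Longrightarrow> a \<noteq> 0" "a \<in> K \<Longrightarrow> inverse a \<in> K"
  using assms by (auto simp: cone_def inverse_eq_divide)

lemma cone_power: "cone K \<Longrightarrow> a \<in> K \<Longrightarrow> a ^ n \<in> K"
  by (induction n) (auto intro: cone_mem)

lemma cone_powi: "cone K \<Longrightarrow> a \<in> K \<Longrightarrow> a powi n \<in> K"
  by (auto simp: power_int_def intro: cone_power cone_mem)

lemma cone_prod: "cone K \<Longrightarrow> (\<And>i. i \<in> A \<Longrightarrow> f i \<in> K) \<Longrightarrow> (\<Prod>i\<in>A. f i) \<in> K"
  by (induction A rule: infinite_finite_induct) (auto intro: cone_mem)

lemma cone_monomial: "cone K \<Longrightarrow> (\<And>i. u i \<in> K) \<Longrightarrow> monomial u e \<in> K"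
  unfolding monomial_def by (intro cone_prod cone_powi)

lemma cone_sum_atMost: "cone K \<Longrightarrow> (\<And>i. i \<le> n \<Longrightarrow> f i \<in> K) \<Longrightarrow> (\<Sum>i\<le>n. f i) \<in> K" for n :: nat
  by (induction n) (auto intro: cone_mem)

lemma cone_of_nat: "cone K \<Longrightarrow> n > 0 \<Longrightarrow> of_nat n \<in> K"
proof (induction n)
  case (Suc n)
  then show ?case by (cases "n = 0") (auto intro: cone_mem)
qed simp

text \<open>Nothing is assumed about \<open>h\<close> outside \<open>K\<close>, where an evaluation
  may be meaningless. The target is only an \<open>inv_monoid\<close>, so that it can be the
  semifield itself, in which sums become \<open>\<oplus>\<close>; \<open>cone_hom\<close> adds
  additivity for maps into fields.\<close>

locale mult_hom =
  fixes K :: "'a::field set" and h :: "'a \<Rightarrow> 'b::inv_monoid"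
  assumes cone: "cone K"
    and hom_one: "h 1 = 1"
    and hom_mult: "a \<in> K \<Longrightarrow> b \<in> K \<Longrightarrow> h (a * b) = h a * h b"
begin

lemma hom_inverse: "a \<in> K \<Longrightarrow> h (inverse a) = inverse (h a)"
proof -
  assume a: "a \<in> K"
  have "h a * h (inverse a) = 1"
    using hom_mult[of a "inverse a"] cone_mem(5,6)[OF cone] a by (simp add: hom_one)
  then show "h (inverse a) = inverse (h a)" using inverse_equality by metis
qed

lemma hom_divide: "a \<in> K \<Longrightarrow> b \<in> K \<Longrightarrow> h (a / b) = h a / h b"
  by (simp add: divide_inverse divide_eq_times_inverse hom_mult hom_inverse cone_mem[OF cone])

lemma hom_power: "a \<in> K \<Longrightarrow> h (a ^ n) = h a ^ n"
  by (induction n) (simp_all add: hom_one hom_mult cone_power cone)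

lemma hom_powi: "a \<in> K \<Longrightarrow> h (a powi n) = h a powi n"
  by (simp add: power_int_def hom_power hom_inverse cone_mem[OF cone])

lemma hom_prod: "(\<And>i. i \<in> A \<Longrightarrow> f i \<in> K) \<Longrightarrow> h (\<Prod>i\<in>A. f i) = (\<Prod>i\<in>A. h (f i))"
  by (induction A rule: infinite_finite_induct) (simp_all add: hom_one hom_mult cone_prod cone)

lemma hom_monomial: "(\<And>i. u i \<in> K) \<Longrightarrow> h (monomial u e) = monomial (\<lambda>i. h (u i)) e"
  by (simp add: monomial_def hom_prod hom_powi cone_powi cone)

end

locale cone_hom = mult_hom K h
  for K :: "'a::field set" and h :: "'a \<Rightarrow> 'b::field" +
  assumes hom_add: "a \<in> K \<Longrightarrow> b \<in> K \<Longrightarrow> h (a + b) = h a + h b"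
begin

lemma hom_sum_atMost:
  "(\<And>i. i \<le> n \<Longrightarrow> f i \<in> K) \<Longrightarrow> h (\<Sum>i\<le>n. f i) = (\<Sum>i\<le>n. h (f i))" for n :: nat
  by (induction n) (simp_all add: hom_add cone_sum_atMost cone)

end

text \<open>Naming the variables that may occur makes it enough that an evaluation point lies in a
  cone on \<open>V\<close>.\<close>

inductive sf_in :: "'v::linorder set \<Rightarrow> 'v ratfun \<Rightarrow> bool" for V where
  sf_in_var: "v \<in> V \<Longrightarrow> sf_in V (rf_var v)"
| sf_in_one: "sf_in V 1"
| sf_in_add: "sf_in V f \<Longrightarrow> sf_in V g \<Longrightarrow> sf_in V (f + g)"
| sf_in_mult: "sf_in V f \<Longrightarrow> sf_in V g \<Longrightarrow> sf_in V (f * g)"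
| sf_in_div: "sf_in V f \<Longrightarrow> sf_in V g \<Longrightarrow> sf_in V (f / g)"

lemma sf_in_subtraction_free: "sf_in V f \<Longrightarrow> subtraction_free f"
  by (induction rule: sf_in.induct) (auto intro: subtraction_free.intros)

lemma cone_sf_in: "cone (Collect (sf_in V))"
  unfolding cone_def
  using sf_in_subtraction_free subtraction_free_nonzero by (auto intro: sf_in.intros)

lemma cone_subtraction_free: "cone (Collect subtraction_free)"
  unfolding cone_def using subtraction_free_nonzero by (auto intro: subtraction_free.intros)

text \<open>Each subtraction-free expression has a representation whose numerator and denominator
  both take values in \<open>L\<close>. Control of the numerator is what carries the induction
  through quotients, where it becomes part of a denominator. All evaluations then reduce to
  evaluations of polynomials.\<close>

lemma cone_hom_rf_eval:
  fixes \<sigma> :: "'v::linorder \<Rightarrow> 'f::field"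
  assumes L: "cone L" and \<sigma>: "\<And>v. v \<in> V \<Longrightarrow> \<sigma> v \<in> L"
  shows "cone_hom (Collect (sf_in V)) (rf_eval \<sigma>)"
    and "sf_in V f \<Longrightarrow> rf_eval \<sigma> f \<in> L"
    and "v \<in> V \<Longrightarrow> rf_eval \<sigma> (rf_var v) = \<sigma> v"
proof -
  let ?e = "mpoly_eval \<sigma>"
  have add: "a + b \<in> L" and mult: "a * b \<in> L" and div: "a / b \<in> L" if "a \<in> L" "b \<in> L" for a b
    using L that by (auto simp: cone_def)
  have L0: "0 \<notin> L" and L1: "1 \<in> L" using L by (auto simp: cone_def)
  have nz: "p \<noteq> 0" if "?e p \<in> L" for p using that L0 by auto
  have repr: "\<exists>p q. f = Fract p q \<and> ?e p \<in> L \<and> ?e q \<in> L" if "sf_in V f" for f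
    using that
  proof induction
    case (sf_in_var v)
    then show ?case unfolding rf_var_def using \<sigma>[of v] L1
      by (intro exI[of _ "Poly_Mapping.single (Poly_Mapping.single v 1) 1"] exI[of _ 1]) auto
  next
    case sf_in_one
    then show ?case unfolding One_fract_def using L1 by (intro exI[of _ 1]) auto
  next
    case (sf_in_add f g)
    then obtain p q p' q' where *: "f = Fract p q" "g = Fract p' q'"
      "?e p \<in> L" "?e q \<in> L" "?e p' \<in> L" "?e q' \<in> L" by blast
    then have "f + g = Fract (p * q' + p' * q) (q * q')" by (simp add: nz)
    moreover have "?e (p * q' + p' * q) \<in> L" "?e (q * q') \<in> L"
      using * by (auto simp: mpoly_eval_add mpoly_eval_mult intro!: add mult)
    ultimately show ?case by blast
  next
    case (sf_in_mult f g)
    then obtain p q p' q' where *: "f = Fract p q" "g = Fract p' q'"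
      "?e p \<in> L" "?e q \<in> L" "?e p' \<in> L" "?e q' \<in> L" by blast
    then have "f * g = Fract (p * p') (q * q')" by simp
    moreover have "?e (p * p') \<in> L" "?e (q * q') \<in> L"
      using * by (auto simp: mpoly_eval_mult intro!: mult)
    ultimately show ?case by blast
  next
    case (sf_in_div f g)
    then obtain p q p' q' where *: "f = Fract p q" "g = Fract p' q'"
      "?e p \<in> L" "?e q \<in> L" "?e p' \<in> L" "?e q' \<in> L" by blast
    then have "f / g = Fract (p * q') (q * p')" by simp
    moreover have "?e (p * q') \<in> L" "?e (q * p') \<in> L"
      using * by (auto simp: mpoly_eval_mult intro!: mult)
    ultimately show ?case by blast
  qed
  have ev: "rf_eval \<sigma> (Fract p q) = ?e p / ?e q" if "?e q \<in> L" for p q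
    using that L0 by (intro rf_eval_Fract) auto
  show "rf_eval \<sigma> f \<in> L" if "sf_in V f"
  proof -
    obtain p q where "f = Fract p q" "?e p \<in> L" "?e q \<in> L" using repr \<open>sf_in V f\<close> by blast
    then show ?thesis by (simp add: ev div)
  qed
  show "cone_hom (Collect (sf_in V)) (rf_eval \<sigma>)"
  proof
    show "rf_eval \<sigma> 1 = 1" using ev[of 1 1] L1 by (simp add: One_fract_def)
  next
    fix f g assume "f \<in> Collect (sf_in V)" "g \<in> Collect (sf_in V)"
    then obtain p q p' q' where *: "f = Fract p q" "g = Fract p' q'"
      "?e p \<in> L" "?e q \<in> L" "?e p' \<in> L" "?e q' \<in> L" using repr by (metis mem_Collect_eq)
    have nz': "?e q \<noteq> 0" "?e q' \<noteq> 0" using *(4,6) L0 by auto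
    have "f * g = Fract (p * p') (q * q')" using * by simp
    moreover have "?e (q * q') \<in> L" using * by (simp add: mpoly_eval_mult mult)
    ultimately show "rf_eval \<sigma> (f * g) = rf_eval \<sigma> f * rf_eval \<sigma> g"
      using * by (simp add: ev mpoly_eval_mult)
    have "f + g = Fract (p * q' + p' * q) (q * q')" using * by (simp add: nz)
    moreover have "?e (q * q') \<in> L" using * by (simp add: mpoly_eval_mult mult)
    ultimately show "rf_eval \<sigma> (f + g) = rf_eval \<sigma> f + rf_eval \<sigma> g"
      using * nz' by (simp add: ev mpoly_eval_mult mpoly_eval_add field_simps)
  qed (rule cone_sf_in)
  show "rf_eval \<sigma> (rf_var v) = \<sigma> v" if "v \<in> V"
    using ev[of 1] L1 by (simp add: rf_var_def)
qed

section \<open>The universal property of the universal semifield\<close>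

text \<open>With a zero adjoined, a semifield is a commutative semiring, in which polynomials with
  nonnegative coefficients can be evaluated term by term.\<close>

datatype 'p with_zero = Zero_elem | Elem (elem: 'p)

instantiation with_zero :: (semifield) comm_semiring_1
begin

definition zero_with_zero where "0 = Zero_elem"
definition one_with_zero where "1 = Elem 1"

fun plus_with_zero where
  "Zero_elem + b = b"
| "a + Zero_elem = a"
| "Elem a + Elem b = Elem (a \<oplus> b)"

fun times_with_zero where
  "Zero_elem * b = Zero_elem"
| "a * Zero_elem = Zero_elem"
| "Elem a * Elem b = Elem (a * b)"

instance
proof
  fix a b c :: "'a with_zero"
  show "a + b + c = a + (b + c)" by (cases a; cases b; cases c) (simp_all add: oplus_assoc)
  show "a + b = b + a" by (cases a; cases b) (simp_all add: oplus_commute)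
  show "0 + a = a" by (simp add: zero_with_zero_def)
  show "a * b * c = a * (b * c)" by (cases a; cases b; cases c) (simp_all add: mult.assoc)
  show "a * b = b * a" by (cases a; cases b) (simp_all add: mult.commute)
  show "1 * a = a" by (cases a) (simp_all add: one_with_zero_def)
  show "(a + b) * c = a * c + b * c"
    by (cases a; cases b; cases c) (simp_all add: mult.commute[of _ "_::'a"] sf_distrib)
  show "0 * a = 0" "a * 0 = 0" by (cases a; simp add: zero_with_zero_def)+
  show "(0::'a with_zero) \<noteq> 1" by (simp add: zero_with_zero_def one_with_zero_def)
qed

end

section \<open>Evaluation of polynomials with nonnegative coefficients in a semifield\<close>

definition nonneg_eval :: "('v \<Rightarrow> 'p::semifield) \<Rightarrow> 'v mpoly \<Rightarrow> 'p with_zero" where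
  "nonneg_eval y p = (\<Sum>m\<in>Poly_Mapping.keys p.
     of_nat (nat (Poly_Mapping.lookup p m)) * monom_eval (\<lambda>v. Elem (y v)) m)"

lemma nonneg_eval_mult:
  assumes "\<And>m. Poly_Mapping.lookup p m \<ge> 0" "\<And>m. Poly_Mapping.lookup q m \<ge> 0"
  shows "nonneg_eval y (p * q) = nonneg_eval y p * nonneg_eval y q"
  unfolding nonneg_eval_def
  by (rule sum_keys_mult[where C = "\<lambda>c. c \<ge> 0"])
    (simp_all add: assms nat_add_distrib nat_mult_distrib monom_eval_add algebra_simps)

lemma nonneg_eval_add:
  assumes "\<And>m. Poly_Mapping.lookup p m \<ge> 0" "\<And>m. Poly_Mapping.lookup q m \<ge> 0"
  shows "nonneg_eval y (p + q) = nonneg_eval y p + nonneg_eval y q"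
  unfolding nonneg_eval_def
  by (rule setsum_keys_plus_distrib) (simp_all add: assms nat_add_distrib algebra_simps)

lemma nonneg_eval_single [simp]:
  "nonneg_eval y (Poly_Mapping.single m 1) = monom_eval (\<lambda>v. Elem (y v)) m"
  by (simp add: nonneg_eval_def)

lemma with_zero_plus_eq_0: "(a::'p::semifield with_zero) + b = 0 \<longleftrightarrow> a = 0 \<and> b = 0"
  by (cases a; cases b) (simp_all add: zero_with_zero_def)

lemma with_zero_times_eq_0: "(a::'p::semifield with_zero) * b = 0 \<longleftrightarrow> a = 0 \<or> b = 0"
  by (cases a; cases b) (simp_all add: zero_with_zero_def)

text \<open>Nothing cancels in a semifield with zero adjoined: a sum is \<open>0\<close> only if all
  summands are, a product only if some factor is. One positive coefficient therefore keeps the value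
  away from \<open>0\<close>.\<close>

lemma nonneg_eval_nonzero:
  assumes "pos_poly p"
  shows "nonneg_eval y p \<noteq> 0"
proof -
  have monom: "monom_eval (\<lambda>v. Elem (y v)) m \<noteq> 0" for m
  proof -
    have "Elem (y v) ^ n \<noteq> 0" for v n
      by (induction n) (simp_all add: with_zero_times_eq_0, simp add: zero_with_zero_def)
    then have "(\<Prod>v\<in>A. Elem (y v) ^ n v) \<noteq> 0" for A n
      by (induction A rule: infinite_finite_induct) (simp_all add: with_zero_times_eq_0)
    then show ?thesis by (simp add: monom_eval_def)
  qed
  have nat: "(of_nat n :: 'b with_zero) = 0 \<longleftrightarrow> n = 0" for n
    by (induction n) (simp_all add: with_zero_plus_eq_0)
  obtain m where m: "m \<in> Poly_Mapping.keys p"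
    using assms by (auto simp: pos_poly_def simp flip: keys_eq_empty)
  have "Poly_Mapping.lookup p m > 0"
    using assms m by (metis pos_poly_def in_keys_iff order_le_less)
  then have "of_nat (nat (Poly_Mapping.lookup p m)) * monom_eval (\<lambda>v. Elem (y v)) m \<noteq> 0"
    by (simp add: with_zero_times_eq_0 nat monom)
  then show ?thesis
    unfolding nonneg_eval_def by (simp add: sum.remove[OF finite_keys m] with_zero_plus_eq_0)
qed

definition pos_eval :: "('v \<Rightarrow> 'p::semifield) \<Rightarrow> 'v mpoly \<Rightarrow> 'p" where
  "pos_eval y p = elem (nonneg_eval y p)"

lemma Elem_pos_eval: "pos_poly p \<Longrightarrow> nonneg_eval y p = Elem (pos_eval y p)"
  using nonneg_eval_nonzero[of p y]
  by (cases "nonneg_eval y p") (simp_all add: pos_eval_def zero_with_zero_def)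

lemma pos_eval_mult:
  fixes p q :: "'v::linorder mpoly"
  assumes "pos_poly p" "pos_poly q"
  shows "pos_eval y (p * q) = pos_eval y p * pos_eval y q"
  using nonneg_eval_mult[of p q y] assms
  by (simp add: Elem_pos_eval pos_poly_mult pos_poly_def[of p] pos_poly_def[of q])

lemma pos_eval_add:
  assumes "pos_poly p" "pos_poly q"
  shows "pos_eval y (p + q) = pos_eval y p \<oplus> pos_eval y q"
  by (metis Elem_pos_eval assms pos_poly_add with_zero.inject plus_with_zero.simps(3)
      nonneg_eval_add pos_poly_def)

lemma sf_divide_cross:
  fixes a b c d :: "'p::semifield"
  assumes "a * d = c * b"
  shows "a / b = c / d"
proof -
  have "a / b = (a * d) * inverse b * inverse d" 
    by (simp add: sf_divide mult.assoc mult.left_commute[of d] mult.commute[of d] sf_left_inverse)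
  also have "\<dots> = (c * b) * inverse b * inverse d" using assms by simp
  also have "\<dots> = c * inverse d"
    by (simp add: mult.assoc mult.left_commute[of b] mult.commute[of b] sf_left_inverse)
  finally show ?thesis by (simp add: sf_divide)
qed

lemma semifield_hom_qsf_unique:
  assumes "semifield_hom h" "semifield_hom h'" "\<And>v. h (qsf_var v) = h' (qsf_var v)"
  shows "h = h'"
proof -
  have "h (Abs_qsf f) = h' (Abs_qsf f)" if "subtraction_free f" for f
    using that
  proof induction
    case (sf_var v)
    then show ?case using assms(3) by (simp add: qsf_var_def)
  next
    case sf_one
    then show ?case using assms(1,2) by (simp add: semifield_hom_def flip: one_qsf_def)
  next
    case (sf_add f g)
    then have "Abs_qsf (f + g) = Abs_qsf f \<oplus> Abs_qsf g"
      by (simp add: oplus_qsf.abs_eq eq_onp_def)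
    then show ?case using sf_add.IH assms(1,2) by (simp add: semifield_hom_def)
  next
    case (sf_mult f g)
    then have "Abs_qsf (f * g) = Abs_qsf f * Abs_qsf g"
      by (simp add: times_qsf.abs_eq eq_onp_def)
    then show ?case using sf_mult.IH assms(1,2) by (simp add: semifield_hom_def)
  next
    case (sf_div f g)
    \<comment> \<open>\<open>semifield_hom\<close> does not mention division, so the quotient is
      characterized as the solution \<open>u\<close> of \<open>u * g = f\<close>, and uniqueness
      comes from cancellation in the target.\<close>
    have fg: "Abs_qsf (f / g) * Abs_qsf g = Abs_qsf f"
      using sf_div.hyps subtraction_free_nonzero[of g]
      by (simp add: times_qsf.abs_eq eq_onp_def subtraction_free.sf_div)
    have "h (Abs_qsf (f / g)) * h (Abs_qsf g) = h (Abs_qsf f)"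
      "h' (Abs_qsf (f / g)) * h' (Abs_qsf g) = h' (Abs_qsf f)"
      using assms(1,2) fg by (metis semifield_hom_def)+
    then show ?case
      using sf_div.IH by (metis invertible_cancel_left invertible_semifield mult.commute)
  qed
  then have "h x = h' x" for x
    by (metis Rep_qsf Rep_qsf_inverse mem_Collect_eq)
  then show ?thesis by auto
qed

text \<open>The homomorphism evaluates numerator and denominator of a representation by polynomials
  with nonnegative coefficients. It is well defined because equality of two such fractions
  cross-multiplies to an identity between positive polynomials, which still makes sense in the
  semifield.\<close>

lemma sf_eval_exists:
  fixes y :: "'v::linorder \<Rightarrow> 'p::semifield"
  shows "\<exists>h. semifield_hom h \<and> (\<forall>v. h (qsf_var v) = y v)"
proof -
  define R where "R = (\<lambda>x r. \<exists>p q. pos_poly p \<and> pos_poly q \<and> Rep_qsf x = Fract p q \<and> r = pos_eval y p / pos_eval y q)"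
  have ex: "\<exists>r. R x r" for x
    using subtraction_free_pos[of "Rep_qsf x"] Rep_qsf[of x] by (auto simp: R_def)
  have uniq: "r = r'" if R: "R x r" "R x r'" for x r r'
  proof -
    obtain p q p' q' where *: "pos_poly p" "pos_poly q" "pos_poly p'" "pos_poly q'"
      "Fract p q = Fract p' q'" "r = pos_eval y p / pos_eval y q" "r' = pos_eval y p' / pos_eval y q'"
      using R unfolding R_def by metis
    then have "p * q' = p' * q" by (simp add: eq_fract pos_poly_def)
    then have "pos_eval y p * pos_eval y q' = pos_eval y p' * pos_eval y q"
      using * by (metis pos_eval_mult)
    then show ?thesis unfolding *(6,7) by (rule sf_divide_cross)
  qed
  define h where "h x = (THE r. R x r)" for x
  have h: "h x = r" if "R x r" for x r
    unfolding h_def using that uniq by blast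
  have hI: "h x = pos_eval y p / pos_eval y q" if "pos_poly p" "pos_poly q" "Rep_qsf x = Fract p q" for x p q
    using that by (intro h) (auto simp: R_def)
  have Rh: "R x (h x)" for x using ex[of x] h by auto
  have "semifield_hom h"
    unfolding semifield_hom_def
  proof (intro conjI allI)
    show "h 1 = 1"
      by (rule h) (auto simp: R_def one_qsf.rep_eq One_fract_def pos_poly_one sf_divide
          intro!: exI[of _ 1] simp flip: invertible_def)
  next
    fix x x'
    obtain p q where *: "pos_poly p" "pos_poly q" "Rep_qsf x = Fract p q" "h x = pos_eval y p / pos_eval y q"
      using Rh[of x] by (auto simp: R_def)
    obtain p' q' where **: "pos_poly p'" "pos_poly q'" "Rep_qsf x' = Fract p' q'" "h x' = pos_eval y p' / pos_eval y q'"
      using Rh[of x'] by (auto simp: R_def)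
    have "Rep_qsf (x * x') = Fract (p * p') (q * q')" using * ** by (simp add: times_qsf.rep_eq)
    moreover have "h x * h x' = pos_eval y (p * p') / pos_eval y (q * q')"
      using * ** by (simp add: pos_eval_mult sf_divide invertible_mult ac_simps)
    ultimately show "h (x * x') = h x * h x'"
      using *(1,2) **(1,2) by (simp add: hI[of "p * p'" "q * q'"] pos_poly_mult)
    have "Rep_qsf (x \<oplus> x') = Fract (p * q' + p' * q) (q * q')"
      using * ** by (simp add: oplus_qsf.rep_eq pos_poly_def)
    moreover have "h x \<oplus> h x' = pos_eval y (p * q' + p' * q) / pos_eval y (q * q')"
    proof -
      have 1: "h x = inverse (pos_eval y (q * q')) * (pos_eval y p * pos_eval y q')"
        using * ** sf_divide_cross[of "pos_eval y p" "pos_eval y q * pos_eval y q'" "pos_eval y p * pos_eval y q'" "pos_eval y q"]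
        by (simp add: pos_eval_mult sf_divide ac_simps)
      have 2: "h x' = inverse (pos_eval y (q * q')) * (pos_eval y p' * pos_eval y q)"
        using * ** sf_divide_cross[of "pos_eval y p'" "pos_eval y q * pos_eval y q'" "pos_eval y p' * pos_eval y q" "pos_eval y q'"]
        by (simp add: pos_eval_mult sf_divide ac_simps)
      show ?thesis unfolding 1 2 using *(1,2) **(1,2)
        by (simp add: pos_eval_add pos_eval_mult pos_poly_mult sf_divide mult.commute[of _ "inverse _"] sf_distrib)
    qed
    ultimately show "h (x \<oplus> x') = h x \<oplus> h x'"
      using *(1,2) **(1,2) by (simp add: hI[of "p * q' + p' * q" "q * q'"] pos_poly_mult pos_poly_add)
  qed
  moreover have "h (qsf_var v) = y v" for v
  proof (rule h)
    show "R (qsf_var v) (y v)" unfolding R_def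
      by (rule exI[of _ "Poly_Mapping.single (Poly_Mapping.single v 1) 1"], rule exI[of _ 1])
        (simp add: pos_poly_one pos_poly_single qsf_var.rep_eq rf_var_def pos_eval_def sf_divide
          nonneg_eval_single[of y 0, simplified] one_with_zero_def)
  qed
  ultimately show ?thesis by blast
qed

lemma sf_eval_hom:
  shows "semifield_hom (sf_eval y)" and "sf_eval y (qsf_var v) = y v"
proof -
  have "\<exists>!h. semifield_hom h \<and> (\<forall>v. h (qsf_var v) = y v)"
    using sf_eval_exists[of y] semifield_hom_qsf_unique by (metis (no_types, lifting))
  from theI'[OF this]
  have "semifield_hom (THE h. semifield_hom h \<and> (\<forall>v. h (qsf_var v) = y v)) \<and>
    (\<forall>v. (THE h. semifield_hom h \<and> (\<forall>v. h (qsf_var v) = y v)) (qsf_var v) = y v)" .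
  moreover have "sf_eval y = (THE h. semifield_hom h \<and> (\<forall>v. h (qsf_var v) = y v))"
    by (rule ext) (simp add: sf_eval_def)
  ultimately show "semifield_hom (sf_eval y)" "sf_eval y (qsf_var v) = y v" by simp_all
qed

section \<open>Positivity and homogeneity\<close>

text \<open>Values of nonzero polynomials in \<open>x\<close> with coefficients in the group
  semiring spanned by the semifield. The sum is that of the field and is unrelated to
  \<open>\<oplus>\<close>, which \<open>\<iota>\<close> need not turn into addition.\<close>

inductive_set pos_comb :: "('p \<Rightarrow> 'f::field) \<Rightarrow> ('n \<Rightarrow> 'f) \<Rightarrow> 'f set" for \<iota> x where
  pos_comb_base: "\<iota> p * monom_eval x m \<in> pos_comb \<iota> x"
| pos_comb_add: "a \<in> pos_comb \<iota> x \<Longrightarrow> b \<in> pos_comb \<iota> x \<Longrightarrow> a + b \<in> pos_comb \<iota> x"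

lemma pos_comb_mult:
  assumes \<iota>: "\<And>p q. \<iota> (p * q) = \<iota> p * \<iota> q"
    and "a \<in> pos_comb \<iota> x" "b \<in> pos_comb \<iota> x"
  shows "a * b \<in> pos_comb \<iota> x"
  using assms(2)
proof induction
  case (pos_comb_base p m)
  show ?case
    using assms(3)
  proof induction
    case (pos_comb_base q n)
    have "\<iota> p * monom_eval x m * (\<iota> q * monom_eval x n) = \<iota> (p * q) * monom_eval x (m + n)"
      by (simp add: \<iota> monom_eval_add)
    then show ?case by (metis pos_comb.pos_comb_base)
  qed (simp add: distrib_left pos_comb.pos_comb_add)
qed (simp add: distrib_right pos_comb.pos_comb_add)

lemma group_ring_map_add: "group_ring_map \<iota> (a + b) = group_ring_map \<iota> a + group_ring_map \<iota> b"
  unfolding group_ring_map_def by (rule setsum_keys_plus_distrib) (simp_all add: algebra_simps)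

lemma group_ring_map_single [simp]: "group_ring_map \<iota> (Poly_Mapping.single p 1) = \<iota> p"
  by (simp add: group_ring_map_def)

text \<open>Two injectivity arguments in succession: a nonzero group-ring element with nonnegative
  coefficients has nonzero image since \<open>\<iota>\<close> extends injectively, and a nonzero
  polynomial in \<open>x\<close> with such images as coefficients is nonzero by algebraic
  independence. Nonnegativity excludes cancellation at both levels.\<close>

lemma pos_comb_nonzero:
  assumes \<iota>: "group_ring_embedding \<iota>" and x: "alg_independent (QP \<iota>) x"
  shows "0 \<notin> pos_comb \<iota> x"
proof -
  define G where "G = {group_ring_map \<iota> a | a. (\<forall>p. Poly_Mapping.lookup a p \<ge> 0) \<and> a \<noteq> 0}"
  have inj: "inj (group_ring_map \<iota>)" and \<iota>1: "\<iota> 1 = 1" using \<iota> by (auto simp: group_ring_embedding_def)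
  have zero: "group_ring_map \<iota> 0 = 0" by (simp add: group_ring_map_def)
  have G0: "0 \<notin> G"
    unfolding G_def using inj zero by (auto dest: injD[where y = 0])
  have Gadd: "g + g' \<in> G" if gG: "g \<in> G" "g' \<in> G" for g g'
  proof -
    obtain a b where ab: "g = group_ring_map \<iota> a" "g' = group_ring_map \<iota> b" "a \<noteq> 0" "b \<noteq> 0"
      "\<forall>p. Poly_Mapping.lookup a p \<ge> 0" "\<forall>p. Poly_Mapping.lookup b p \<ge> 0"
      using gG unfolding G_def by auto
    have "a + b \<noteq> 0"
    proof
      assume "a + b = 0"
      then have "Poly_Mapping.lookup a p + Poly_Mapping.lookup b p = 0" for p
        by (metis lookup_add lookup_zero)
      then have "Poly_Mapping.lookup a p = 0" for p
        using ab(5,6) by (metis add_nonneg_eq_0_iff)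
      then show False using ab(3) by (simp add: poly_mapping_eq_iff fun_eq_iff)
    qed
    then show ?thesis using ab unfolding G_def
      by (auto simp: lookup_add group_ring_map_add intro!: exI[of _ "a + b"])
  qed
  have GQ: "insert 0 G \<subseteq> QP \<iota>"
  proof
    fix g assume "g \<in> insert 0 G"
    then obtain a where "g = group_ring_map \<iota> a" using zero unfolding G_def by auto
    then have "g = group_ring_map \<iota> a / group_ring_map \<iota> (Poly_Mapping.single 1 1)"
      "group_ring_map \<iota> (Poly_Mapping.single 1 1) \<noteq> 0" by (simp_all add: \<iota>1)
    then show "g \<in> QP \<iota>" unfolding QP_def by blast
  qed
  let ?ev = "\<lambda>P. \<Sum>m\<in>Poly_Mapping.keys P. Poly_Mapping.lookup P m * monom_eval x m"
  have "\<exists>P. P \<noteq> 0 \<and> (\<forall>m. Poly_Mapping.lookup P m \<in> insert 0 G) \<and> a = ?ev P"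
    if "a \<in> pos_comb \<iota> x" for a
    using that
  proof induction
    case (pos_comb_base p m)
    have "\<iota> p \<in> G"
      unfolding G_def by (auto intro!: exI[of _ "Poly_Mapping.single p 1"] simp: lookup_single when_def
        simp flip: keys_eq_empty)
    then show ?case using G0
      by (intro exI[of _ "Poly_Mapping.single m (\<iota> p)"])
        (auto simp: lookup_single when_def simp flip: keys_eq_empty)
  next
    case (pos_comb_add a b)
    then obtain P Q where PQ: "P \<noteq> 0" "Q \<noteq> 0" "\<forall>m. Poly_Mapping.lookup P m \<in> insert 0 G"
      "\<forall>m. Poly_Mapping.lookup Q m \<in> insert 0 G" "a = ?ev P" "b = ?ev Q" by blast
    have ev: "?ev (P + Q) = ?ev P + ?ev Q"
      by (rule setsum_keys_plus_distrib) (simp_all add: algebra_simps)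
    have mem: "Poly_Mapping.lookup (P + Q) m \<in> insert 0 G" for m
      using PQ(3,4) Gadd by (auto simp: lookup_add) (metis add_0 add_0_right)+
    \<comment> \<open>A nonzero coefficient of \<open>P\<close> lies in \<open>G\<close>, and adding
      a coefficient of \<open>Q\<close>, which is \<open>0\<close> or in \<open>G\<close>, stays in
      \<open>G\<close>; so this term survives in \<open>P + Q\<close>.\<close>
    obtain m where "Poly_Mapping.lookup P m \<noteq> 0"
      using PQ(1) by (metis poly_mapping_eqI lookup_zero)
    then have "Poly_Mapping.lookup (P + Q) m \<in> G"
      using PQ(3,4) Gadd by (metis lookup_add add_0_right insertE)
    then have "P + Q \<noteq> 0" using G0 by auto
    then show ?case using ev mem PQ(5,6) by (intro exI[of _ "P + Q"]) simp
  qed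
  note repr = this
  show ?thesis
  proof
    assume "0 \<in> pos_comb \<iota> x"
    then obtain P where P: "P \<noteq> 0" "\<forall>m. Poly_Mapping.lookup P m \<in> insert 0 G" "?ev P = 0"
      using repr by metis
    from P(2) GQ have "\<forall>m. Poly_Mapping.lookup P m \<in> QP \<iota>" by blast
    with P(1,3) x show False unfolding alg_independent_def by blast
  qed
qed

text \<open>The quotients of elements of a set that contains 1, misses \<open>0\<close> and is
  closed under sum and product form a cone.\<close>

lemma positive_cone_exists:
  assumes \<iota>: "group_ring_embedding \<iota>" and x: "alg_independent (QP \<iota>) x"
  shows "\<exists>L. cone L \<and> (\<forall>p. \<iota> p \<in> L) \<and> (\<forall>i. x i \<in> L)"
proof -
  let ?C = "pos_comb \<iota> x"
  define L where "L = {a / b | a b. a \<in> ?C \<and> b \<in> ?C}"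
  have \<iota>1: "\<iota> 1 = 1" and \<iota>m: "\<And>p q. \<iota> (p * q) = \<iota> p * \<iota> q"
    using \<iota> by (auto simp: group_ring_embedding_def)
  have nz: "a \<noteq> 0" if "a \<in> ?C" for a using that pos_comb_nonzero[OF assms] by auto
  have one: "1 \<in> ?C" using pos_comb_base[of \<iota> 1 x 0] \<iota>1 by simp
  have sub: "a \<in> L" if "a \<in> ?C" for a
    unfolding L_def using that one by (metis (mono_tags, lifting) div_by_1 mem_Collect_eq)
  have "cone L"
    unfolding cone_def
  proof (intro conjI ballI)
    show "1 \<in> L" by (rule sub[OF one])
    show "0 \<notin> L" unfolding L_def using nz by fastforce
    fix u v assume "u \<in> L" "v \<in> L"
    then obtain a b c d where *: "u = a / b" "v = c / d" "a \<in> ?C" "b \<in> ?C" "c \<in> ?C" "d \<in> ?C"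
      unfolding L_def by blast
    note mult = pos_comb_mult[OF \<iota>m]
    have "u + v = (a * d + c * b) / (b * d)" "u * v = (a * c) / (b * d)" "u / v = (a * d) / (b * c)"
      using nz[OF *(3)] nz[OF *(4)] nz[OF *(5)] nz[OF *(6)] by (simp_all add: *(1,2) field_simps)
    then show "u + v \<in> L" "u * v \<in> L" "u / v \<in> L"
      unfolding L_def using *(3-6) by (blast intro: mult pos_comb_add)+
  qed
  moreover have "\<iota> p \<in> L" for p using sub pos_comb_base[of \<iota> p x 0] by simp
  moreover have "x i \<in> L" for i
    using sub pos_comb_base[of \<iota> 1 x "Poly_Mapping.single i 1"] by (simp add: \<iota>1)
  ultimately show ?thesis by blast
qed

section \<open>The grading on rational functions\<close>

lemma monom_degree_add: "monom_degree b (m + n) i = monom_degree b m i + monom_degree b n i"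
  unfolding monom_degree_def by (rule setsum_keys_plus_distrib) (simp_all add: algebra_simps)

lemma homogeneous_poly_mult:
  assumes "homogeneous_poly b g p" "homogeneous_poly b g' q"
  shows "homogeneous_poly b (\<lambda>i. g i + g' i) (p * q)"
  using assms keys_mult[of p q]
  by (fastforce simp: homogeneous_poly_def fun_eq_iff monom_degree_add)

lemma homogeneous_poly_add:
  assumes "homogeneous_poly b g p" "homogeneous_poly b g q"
  shows "homogeneous_poly b g (p + q)"
  using assms keys_add[of p q] by (fastforce simp: homogeneous_poly_def)

lemma homogeneous_poly_single: "homogeneous_poly b (monom_degree b m) (Poly_Mapping.single m c)"
  by (simp add: homogeneous_poly_def)

lemma homogeneous_one: "homogeneous b (\<lambda>_. 0) 1"
proof -
  have "homogeneous_poly b (\<lambda>_. 0) 1"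
    by (simp add: homogeneous_poly_def monom_degree_def fun_eq_iff)
  then show ?thesis unfolding homogeneous_def One_fract_def
    by (intro exI[of _ 1] exI[of _ "\<lambda>_. 0"]) auto
qed

lemma homogeneous_var: "homogeneous b (var_degree b v) (rf_var v)"
proof -
  have "monom_degree b (Poly_Mapping.single v 1) = var_degree b v"
    by (simp add: monom_degree_def fun_eq_iff)
  then have "homogeneous_poly b (var_degree b v) (Poly_Mapping.single (Poly_Mapping.single v 1) 1)"
    by (metis homogeneous_poly_single)
  moreover have "homogeneous_poly b (\<lambda>_. 0) 1"
    by (simp add: homogeneous_poly_def monom_degree_def fun_eq_iff)
  ultimately show ?thesis unfolding homogeneous_def rf_var_def
    by (intro exI[of _ "Poly_Mapping.single (Poly_Mapping.single v 1) 1"] exI[of _ 1] exI) auto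
qed

lemma homogeneous_mult:
  assumes "homogeneous b g f" "homogeneous b g' f'"
  shows "homogeneous b (\<lambda>i. g i + g' i) (f * f')"
proof -
  obtain p q g1 g2 where 1: "q \<noteq> 0" "f = Fract p q" "homogeneous_poly b g1 p"
    "homogeneous_poly b g2 q" "\<And>i. g i = g1 i - g2 i"
    using assms(1) unfolding homogeneous_def by blast
  obtain p' q' g1' g2' where 2: "q' \<noteq> 0" "f' = Fract p' q'" "homogeneous_poly b g1' p'"
    "homogeneous_poly b g2' q'" "\<And>i. g' i = g1' i - g2' i"
    using assms(2) unfolding homogeneous_def by blast
  show ?thesis unfolding homogeneous_def
    using homogeneous_poly_mult[OF 1(3) 2(3)] homogeneous_poly_mult[OF 1(4) 2(4)] 1 2
    by (intro exI[of _ "p * p'"] exI[of _ "q * q'"] exI[of _ "\<lambda>i. g1 i + g1' i"] exI[of _ "\<lambda>i. g2 i + g2' i"])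
      simp
qed

lemma homogeneous_inverse:
  assumes "homogeneous b g f" "f \<noteq> 0"
  shows "homogeneous b (\<lambda>i. - g i) (inverse f)"
proof -
  obtain p q g1 g2 where 1: "q \<noteq> 0" "f = Fract p q" "homogeneous_poly b g1 p"
    "homogeneous_poly b g2 q" "\<And>i. g i = g1 i - g2 i"
    using assms(1) unfolding homogeneous_def by blast
  have "p \<noteq> 0" using 1 assms(2) by (auto simp: fract_collapse)
  then show ?thesis unfolding homogeneous_def using 1
    by (intro exI[of _ q] exI[of _ p] exI[of _ g2] exI[of _ g1]) simp
qed

lemma homogeneous_add:
  assumes "homogeneous b g f" "homogeneous b g f'"
  shows "homogeneous b g (f + f')"
proof -
  obtain p q g1 g2 where 1: "q \<noteq> 0" "f = Fract p q" "homogeneous_poly b g1 p"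
    "homogeneous_poly b g2 q" "\<And>i. g i = g1 i - g2 i"
    using assms(1) unfolding homogeneous_def by blast
  obtain p' q' g1' g2' where 2: "q' \<noteq> 0" "f' = Fract p' q'" "homogeneous_poly b g1' p'"
    "homogeneous_poly b g2' q'" "\<And>i. g i = g1' i - g2' i"
    using assms(2) unfolding homogeneous_def by blast
  have g1': "g1' i + g2 i = g1 i + g2' i" for i using 1(5)[of i] 2(5)[of i] by simp
  have "homogeneous_poly b (\<lambda>i. g1 i + g2' i) (p * q' + p' * q)"
    using homogeneous_poly_mult[OF 1(3) 2(4)] homogeneous_poly_mult[OF 2(3) 1(4)]
    by (simp add: g1' homogeneous_poly_add)
  moreover have "f + f' = Fract (p * q' + p' * q) (q * q')" using 1 2 by simp
  ultimately show ?thesis unfolding homogeneous_def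
    using homogeneous_poly_mult[OF 1(4) 2(4)] 1(1,5) 2(1)
    by (intro exI[of _ "p * q' + p' * q"] exI[of _ "q * q'"] exI[of _ "\<lambda>i. g1 i + g2' i"]
        exI[of _ "\<lambda>i. g2 i + g2' i"]) simp
qed

text \<open>After cross-multiplication a single polynomial is homogeneous for two degrees, and any
  one of its terms shows that they agree. Such a term exists because \<open>f\<close> is nonzero;
  \<open>0\<close> is homogeneous of every degree. This justifies the definite description in
  \<open>g_entry\<close>.\<close>

lemma homogeneous_unique:
  assumes "homogeneous b g f" "homogeneous b g' f" "f \<noteq> 0"
  shows "g = g'"
proof -
  obtain p q g1 g2 where 1: "q \<noteq> 0" "f = Fract p q" "homogeneous_poly b g1 p"
    "homogeneous_poly b g2 q" "\<And>i. g i = g1 i - g2 i"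
    using assms(1) unfolding homogeneous_def by blast
  obtain p' q' g1' g2' where 2: "q' \<noteq> 0" "f = Fract p' q'" "homogeneous_poly b g1' p'"
    "homogeneous_poly b g2' q'" "\<And>i. g' i = g1' i - g2' i"
    using assms(2) unfolding homogeneous_def by blast
  have nz: "p \<noteq> 0" using 1 assms(3) by (auto simp: fract_collapse)
  have eq: "p * q' = p' * q" using 1 2 by (simp add: eq_fract)
  have "p * q' \<noteq> 0" using nz 2(1) by simp
  then obtain m where "m \<in> Poly_Mapping.keys (p * q')" by (metis keys_eq_empty ex_in_conv)
  then have "(\<lambda>i. g1 i + g2' i) = monom_degree b m" "(\<lambda>i. g1' i + g2 i) = monom_degree b m"
    using homogeneous_poly_mult[OF 1(3) 2(4)] homogeneous_poly_mult[OF 2(3) 1(4)]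
    unfolding eq homogeneous_poly_def by auto
  then have "g1 i + g2' i = g1' i + g2 i" for i by (metis (no_types, lifting))
  then have "g i = g' i" for i
    by (metis 1(5) 2(5) add_diff_cancel_right diff_add_cancel diff_diff_eq add.commute)
  then show ?thesis by auto
qed

lemma homogeneous_power: "homogeneous b g f \<Longrightarrow> homogeneous b (\<lambda>i. g i * int n) (f ^ n)"
proof (induction n)
  case (Suc n)
  then show ?case using homogeneous_mult[of b g f "\<lambda>i. g i * int n" "f ^ n"]
    by (simp add: algebra_simps)
qed (simp add: homogeneous_one)

lemma homogeneous_powi:
  assumes "homogeneous b g f" "f \<noteq> 0"
  shows "homogeneous b (\<lambda>i. g i * n) (f powi n)"
proof (cases n rule: int_cases2)
  case (nonneg k)
  then show ?thesis using homogeneous_power[OF assms(1)] by simp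
next
  case (nonpos k)
  then show ?thesis
    using homogeneous_power[OF homogeneous_inverse[OF assms], of k] by (simp add: power_int_minus power_inverse)
qed

lemma homogeneous_monomial:
  assumes "\<And>j. homogeneous b (g j) (u j)" "\<And>j. u j \<noteq> 0"
  shows "homogeneous b (\<lambda>i. \<Sum>j\<in>UNIV. g j i * e j) (monomial u e)"
proof -
  have "homogeneous b (\<lambda>i. \<Sum>j\<in>A. g j i * e j) (\<Prod>j\<in>A. u j powi e j)" if "finite A" for A
    using that
    by induction (simp_all add: homogeneous_one homogeneous_mult homogeneous_powi assms)
  then show ?thesis by (simp add: monomial_def)
qed

lemma homogeneous_sum_atMost:
  "(\<And>s. s \<le> n \<Longrightarrow> homogeneous b g (f s)) \<Longrightarrow> homogeneous b g (\<Sum>s\<le>n. f s)" for n :: nat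
  by (induction n) (simp_all add: homogeneous_add)

section \<open>Exchange matrices and c-vectors\<close>

definition mutate_matrix :: "('n \<Rightarrow> nat) \<Rightarrow> 'n \<Rightarrow> ('n \<Rightarrow> 'n \<Rightarrow> int) \<Rightarrow> 'n \<Rightarrow> 'n \<Rightarrow> int" where
  "mutate_matrix d k b = (\<lambda>i j. if i = k \<or> j = k then - b i j
     else b i j + [b i k]\<^sub>+ * int (d k) * b k j + b i k * int (d k) * [- b k j]\<^sub>+)"

primrec matrix_pattern :: "('n \<Rightarrow> 'n \<Rightarrow> int) \<Rightarrow> ('n \<Rightarrow> nat) \<Rightarrow> 'n list \<Rightarrow> 'n \<Rightarrow> 'n \<Rightarrow> int" where
  "matrix_pattern b d [] = b"
| "matrix_pattern b d (k # t) = mutate_matrix d k (matrix_pattern b d t)"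

text \<open>Coefficient mutation read off in exponents. The exponent of y_i in the tropical value of
  Z_k is \<open>- (d k * [- c_ik]_+)\<close>; raising that value to the power \<open>- b_kj\<close>
  produces the last term.\<close>

primrec c_pattern :: "('n \<Rightarrow> 'n \<Rightarrow> int) \<Rightarrow> ('n \<Rightarrow> nat) \<Rightarrow> 'n list \<Rightarrow> 'n \<Rightarrow> 'n \<Rightarrow> int" where
  "c_pattern b d [] = (\<lambda>i j. if i = j then 1 else 0)"
| "c_pattern b d (k # t) = (\<lambda>i j. if j = k then - c_pattern b d t i k
     else c_pattern b d t i j + c_pattern b d t i k * int (d k) * [matrix_pattern b d t k j]\<^sub>+
       + matrix_pattern b d t k j * int (d k) * [- c_pattern b d t i k]\<^sub>+)"

text \<open>The degree of the right-hand side of the exchange relation, divided by the old variable.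
  The last sum comes from division by the tropical value of Z_k, since y_l has minus the l-th column
  of \<open>b\<close> as its degree.\<close>

primrec g_pattern :: "('n::finite \<Rightarrow> 'n \<Rightarrow> int) \<Rightarrow> ('n \<Rightarrow> nat) \<Rightarrow> 'n list \<Rightarrow> 'n \<Rightarrow> 'n \<Rightarrow> int" where
  "g_pattern b d [] = (\<lambda>i j. if i = j then 1 else 0)"
| "g_pattern b d (k # t) = (\<lambda>i j. if j = k
     then - g_pattern b d t i k
       + int (d k) * (\<Sum>l\<in>UNIV. g_pattern b d t i l * [- matrix_pattern b d t l k]\<^sub>+)
       - int (d k) * (\<Sum>l\<in>UNIV. b i l * [- c_pattern b d t l k]\<^sub>+)
     else g_pattern b d t i j)"

text \<open>The same symmetrizer works: multiplying by it turns \<open>[b i k]_+\<close> into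
  \<open>[- b k i]_+\<close>, so the two correction terms of the mutation rule exchange roles under
  transposition.\<close>

lemma skew_symmetrizable_mutate:
  assumes "skew_symmetrizable b"
  shows "skew_symmetrizable (mutate_matrix d k b)"
proof -
  obtain s where s: "\<And>i. s i > 0" "\<And>i j. s i * b i j = - (s j * b j i)"
    using assms unfolding skew_symmetrizable_def by blast
  have pp: "c * [a]\<^sub>+ = [c * a]\<^sub>+" if "c > 0" for a c :: int
    using that by (simp add: max_mult_distrib_left)
  have "s i * mutate_matrix d k b i j = - (s j * mutate_matrix d k b j i)" for i j
  proof (cases "i = k \<or> j = k")
    case True
    then show ?thesis using s(2)[of i j] by (auto simp: mutate_matrix_def)
  next
    case False
    have 1: "s i * [b i k]\<^sub>+ = s k * [- b k i]\<^sub>+" "s j * [b j k]\<^sub>+ = s k * [- b k j]\<^sub>+"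
      using s(1) s(2)[of i k] s(2)[of j k] by (simp_all add: pp)
    have "s i * mutate_matrix d k b i j = s i * b i j + (s i * [b i k]\<^sub>+) * int (d k) * b k j
        + (s i * b i k) * int (d k) * [- b k j]\<^sub>+"
      using False by (simp add: mutate_matrix_def algebra_simps)
    also have "\<dots> = - (s j * b j i) + s k * [- b k i]\<^sub>+ * int (d k) * b k j
        - s k * b k i * int (d k) * [- b k j]\<^sub>+"
      unfolding 1 s(2)[of i] by simp
    also have "\<dots> = - (s j * b j i + (s j * [b j k]\<^sub>+) * int (d k) * b k i
        + (s j * b j k) * int (d k) * [- b k i]\<^sub>+)"
      unfolding 1 s(2)[of j k] by (simp add: algebra_simps)
    also have "\<dots> = - (s j * mutate_matrix d k b j i)"
      using False by (simp add: mutate_matrix_def algebra_simps)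
    finally show ?thesis .
  qed
  then show ?thesis using s(1) unfolding skew_symmetrizable_def by blast
qed

lemma skew_symmetrizable_matrix_pattern:
  "skew_symmetrizable b \<Longrightarrow> skew_symmetrizable (matrix_pattern b d t)"
  by (induction t) (simp_all add: skew_symmetrizable_mutate)

lemma skew_symmetrizable_diag: "skew_symmetrizable b \<Longrightarrow> b k k = 0"
  unfolding skew_symmetrizable_def by (metis add.inverse_unique add_eq_0_iff equation_minus_iff
      less_irrefl mult_eq_0_iff neg_equal_zero)

lemma bmat_coeff_pattern [simp]:
  "bmat (coeff_pattern S t) = matrix_pattern (bmat S) (degs S) t"
  "degs (coeff_pattern S t) = degs S"
proof -
  have "bmat (coeff_pattern S t) = matrix_pattern (bmat S) (degs S) t \<and> degs (coeff_pattern S t) = degs S"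
  proof (induction t)
    case (Cons k t)
    then have "bmat (coeff_pattern S t) = matrix_pattern (bmat S) (degs S) t" "degs (coeff_pattern S t) = degs S" by auto
    then show ?case by (simp add: mutate_coeff_def mutate_matrix_def cong: if_cong)
  qed simp
  then show "bmat (coeff_pattern S t) = matrix_pattern (bmat S) (degs S) t"
    "degs (coeff_pattern S t) = degs S" by simp_all
qed

lemma bmat_cluster_pattern [simp]:
  "bmat (cluster_pattern \<iota> S t) = matrix_pattern (bmat S) (degs S) t"
  "degs (cluster_pattern \<iota> S t) = degs S"
proof -
  have "bmat (cluster_pattern \<iota> S t) = matrix_pattern (bmat S) (degs S) t \<and> degs (cluster_pattern \<iota> S t) = degs S"
  proof (induction t)
    case (Cons k t)
    then have "bmat (cluster_pattern \<iota> S t) = matrix_pattern (bmat S) (degs S) t" "degs (cluster_pattern \<iota> S t) = degs S" by auto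
    then show ?case by (simp add: mutate_coeff_def mutate_def mutate_matrix_def cong: if_cong)
  qed simp
  then show "bmat (cluster_pattern \<iota> S t) = matrix_pattern (bmat S) (degs S) t"
    "degs (cluster_pattern \<iota> S t) = degs S" by simp_all
qed

lemma pos_part_diff: "[a]\<^sub>+ - [- a]\<^sub>+ = a"
  by (auto simp: max_def)

text \<open>By induction on the path, each column of the new identity is a combination of columns
  \<open>j\<close> and \<open>k\<close> of the old one. Besides giving the degree of yhat, the
  identity matches the x-exponents in \<open>yhat_pattern\<close>.\<close>

lemma g_matrix_c_matrix:
  fixes b :: "'n::finite \<Rightarrow> 'n \<Rightarrow> int"
  assumes "skew_symmetrizable b"
  shows "(\<Sum>l\<in>UNIV. g_pattern b d t i l * matrix_pattern b d t l j)
    = (\<Sum>l\<in>UNIV. b i l * c_pattern b d t l j)"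
proof (induction t arbitrary: j)
  case Nil
  show ?case
    by (simp add: if_distrib[where f = "\<lambda>x. x * _"] if_distrib[where f = "\<lambda>x. _ * x"] cong: if_cong)
next
  case (Cons k t)
  let ?B = "matrix_pattern b d t" and ?C = "c_pattern b d t" and ?G = "g_pattern b d t"
  let ?dk = "int (d k)"
  have Bkk: "?B k k = 0"
    by (rule skew_symmetrizable_diag[OF skew_symmetrizable_matrix_pattern[OF assms]])
  show ?case
  proof (cases "j = k")
    case True
    have "(\<Sum>l\<in>UNIV. g_pattern b d (k # t) i l * matrix_pattern b d (k # t) l k)
        = (\<Sum>l\<in>UNIV. - (?G i l * ?B l k))"
      by (rule sum.cong) (auto simp: mutate_matrix_def Bkk)
    also have "\<dots> = (\<Sum>l\<in>UNIV. b i l * c_pattern b d (k # t) l k)"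
      using Cons.IH[of k] by (simp add: sum_negf)
    finally show ?thesis using True by simp
  next
    case False
    have "(\<Sum>l\<in>UNIV. g_pattern b d (k # t) i l * matrix_pattern b d (k # t) l j)
        = g_pattern b d (k # t) i k * (- ?B k j)
          + (\<Sum>l\<in>UNIV - {k}. ?G i l * (?B l j + [?B l k]\<^sub>+ * ?dk * ?B k j + ?B l k * ?dk * [- ?B k j]\<^sub>+))"
      using False by (subst sum.remove[of UNIV k]) (auto simp: mutate_matrix_def intro!: sum.cong)
    \<comment> \<open>Mutation changes column \<open>k\<close> of G and row \<open>k\<close> of B,
      hence the separation of \<open>l = k\<close>. In the full sum over old entries that summand is
      just \<open>?G i k * ?B k j\<close>, because \<open>?B k k\<close> is
      \<open>0\<close>.\<close>
    also have "(\<Sum>l\<in>UNIV - {k}. ?G i l * (?B l j + [?B l k]\<^sub>+ * ?dk * ?B k j + ?B l k * ?dk * [- ?B k j]\<^sub>+))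
        = (\<Sum>l\<in>UNIV. ?G i l * (?B l j + [?B l k]\<^sub>+ * ?dk * ?B k j + ?B l k * ?dk * [- ?B k j]\<^sub>+)) - ?G i k * ?B k j"
      using sum.remove[of UNIV k "\<lambda>l. ?G i l * (?B l j + [?B l k]\<^sub>+ * ?dk * ?B k j + ?B l k * ?dk * [- ?B k j]\<^sub>+)"]
      by (simp add: Bkk)
    also have "g_pattern b d (k # t) i k * (- ?B k j) + \<dots>
        = (\<Sum>l\<in>UNIV. ?G i l * (?B l j + [?B l k]\<^sub>+ * ?dk * ?B k j + ?B l k * ?dk * [- ?B k j]\<^sub>+))
          - (\<Sum>l\<in>UNIV. ?G i l * ([- ?B l k]\<^sub>+ * ?dk * ?B k j))
          + (\<Sum>l\<in>UNIV. b i l * (?dk * [- ?C l k]\<^sub>+ * ?B k j))"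
      by (simp add: algebra_simps sum_distrib_left sum_negf)
    also have "(\<Sum>l\<in>UNIV. ?G i l * (?B l j + [?B l k]\<^sub>+ * ?dk * ?B k j + ?B l k * ?dk * [- ?B k j]\<^sub>+))
          - (\<Sum>l\<in>UNIV. ?G i l * ([- ?B l k]\<^sub>+ * ?dk * ?B k j))
        = (\<Sum>l\<in>UNIV. ?G i l * ?B l j + (?G i l * ?B l k) * (?dk * [?B k j]\<^sub>+))"
      unfolding sum_subtractf[symmetric]
    proof (rule sum.cong[OF refl])
      fix l
      \<comment> \<open>With both positive parts expressed by their negative counterparts, the terms
        in \<open>[- ?B l k]_+\<close> cancel, and what is left of the correction is
        \<open>?B l k\<close> times \<open>?dk * [?B k j]_+\<close>.\<close>
      have 1: "[?B l k]\<^sub>+ = ?B l k + [- ?B l k]\<^sub>+" "[?B k j]\<^sub>+ = ?B k j + [- ?B k j]\<^sub>+"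
        using pos_part_diff[of "?B l k"] pos_part_diff[of "?B k j"] by linarith+
      show "?G i l * (?B l j + [?B l k]\<^sub>+ * ?dk * ?B k j + ?B l k * ?dk * [- ?B k j]\<^sub>+)
          - ?G i l * ([- ?B l k]\<^sub>+ * ?dk * ?B k j)
        = ?G i l * ?B l j + (?G i l * ?B l k) * (?dk * [?B k j]\<^sub>+)"
        unfolding 1 by (simp add: algebra_simps)
    qed
    also have "\<dots> = (\<Sum>l\<in>UNIV. b i l * ?C l j) + (\<Sum>l\<in>UNIV. b i l * ?C l k) * (?dk * [?B k j]\<^sub>+)"
      by (simp add: sum.distrib Cons.IH flip: sum_distrib_right)
    also have "\<dots> + (\<Sum>l\<in>UNIV. b i l * (?dk * [- ?C l k]\<^sub>+ * ?B k j))
        = (\<Sum>l\<in>UNIV. b i l * c_pattern b d (k # t) l j)"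
      unfolding sum_distrib_right sum.distrib[symmetric] using False
      by (intro sum.cong) (simp_all add: algebra_simps)
    finally show ?thesis .
  qed
qed

section \<open>Coefficient patterns in the tropical semifield\<close>

lemma semifield_hom_inverse: "semifield_hom h \<Longrightarrow> h (inverse a) = inverse (h a)"
proof -
  assume "semifield_hom h"
  then have "h a * h (inverse a) = 1"
    by (metis semifield_hom_def sf_left_inverse mult.commute)
  then show "h (inverse a) = inverse (h a)" using inverse_equality by metis
qed

lemma semifield_hom_power: "semifield_hom h \<Longrightarrow> h (a ^ n) = h a ^ n"
  by (induction n) (simp_all add: semifield_hom_def)

lemma semifield_hom_powi: "semifield_hom h \<Longrightarrow> h (a powi n) = h a powi n"
  by (simp add: power_int_def semifield_hom_power semifield_hom_inverse)

lemma semifield_hom_osum: "semifield_hom h \<Longrightarrow> h (osum f n) = osum (\<lambda>s. h (f s)) n"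
  by (induction n) (simp_all add: semifield_hom_def)

text \<open>Coefficient mutation is written in the semifield operations alone, so homomorphisms
  commute with it. Hence tropicalized Y-functions can be computed by mutating inside the tropical
  semifield.\<close>

lemma semifield_hom_coeff_pattern:
  assumes h: "semifield_hom h"
    and S: "bmat S' = bmat S" "degs S' = degs S" "\<And>i. yco S' i = h (yco S i)" "\<And>i s. zcf S' i s = h (zcf S i s)"
  shows "yco (coeff_pattern S' t) i = h (yco (coeff_pattern S t) i)"
    and "zcf (coeff_pattern S' t) i s = h (zcf (coeff_pattern S t) i s)"
proof -
  note hom = semifield_hom_inverse[OF h] semifield_hom_power[OF h] semifield_hom_powi[OF h]
    semifield_hom_osum[OF h]
  have hm: "h (a * c) = h a * h c" for a c using h by (simp add: semifield_hom_def)
  have "(\<forall>i. yco (coeff_pattern S' t) i = h (yco (coeff_pattern S t) i)) \<and>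
    (\<forall>i s. zcf (coeff_pattern S' t) i s = h (zcf (coeff_pattern S t) i s))"
    by (induction t) (simp_all add: S mutate_coeff_def Z_at_def hom hm)
  then show "yco (coeff_pattern S' t) i = h (yco (coeff_pattern S t) i)"
    "zcf (coeff_pattern S' t) i s = h (zcf (coeff_pattern S t) i s)" by simp_all
qed

abbreviation trop_lookup :: "'v trop \<Rightarrow> 'v \<Rightarrow> int" where
  "trop_lookup a \<equiv> Poly_Mapping.lookup (trop_exponent a)"

lemma trop_lookup_simps [simp]:
  "trop_lookup 1 v = 0"
  "trop_lookup (a * c) v = trop_lookup a v + trop_lookup c v"
  "trop_lookup (inverse a) v = - trop_lookup a v"
  "trop_lookup (a \<oplus> c) v = min (trop_lookup a v) (trop_lookup c v)"
  "trop_lookup (trop_var w) v = (if v = w then 1 else 0)"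
  by (simp_all add: one_trop.rep_eq times_trop.rep_eq inverse_trop.rep_eq oplus_trop.rep_eq
      trop_var.rep_eq lookup_add pm_min.rep_eq lookup_single when_def)

lemma trop_lookup_power [simp]: "trop_lookup (a ^ n) v = int n * trop_lookup a v"
  by (induction n) (simp_all add: algebra_simps)

lemma trop_lookup_powi [simp]: "trop_lookup (a powi n) v = n * trop_lookup a v"
  by (simp add: power_int_def)

lemma trop_lookup_osum_ge: "(\<And>s. s \<le> n \<Longrightarrow> trop_lookup (f s) v \<ge> m) \<Longrightarrow> trop_lookup (osum f n) v \<ge> m"
  by (induction n) simp_all

lemma trop_lookup_osum_le: "s \<le> n \<Longrightarrow> trop_lookup (osum f n) v \<le> trop_lookup (f s) v"
  by (induction n) (auto simp: le_Suc_eq)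

lemma trop_lookup_universal_z [simp]:
  "trop_lookup (universal_z trop_var d k s) (Yv i) = 0"
  "trop_lookup (universal_z trop_var d k s) v \<ge> 0"
  by (simp_all add: universal_z_def)

text \<open>A mutation at \<open>k\<close> reverses Z_k, and two reversals cancel. The bound on
  \<open>s\<close> matters: beyond the degree the subtraction is truncated and reversal is no longer
  an involution.\<close>

lemma zcf_coeff_pattern_cases:
  fixes z :: "'n \<Rightarrow> nat \<Rightarrow> 'p::semifield"
  shows "(\<forall>s\<le>degs S k. zcf (coeff_pattern S t) k s = zcf S k s) \<or>
    (\<forall>s\<le>degs S k. zcf (coeff_pattern S t) k s = zcf S k (degs S k - s))"
proof (induction t)
  case (Cons l t)
  then show ?case by (auto simp: mutate_coeff_def)
qed simp

definition trop_coeffs :: "('n \<Rightarrow> 'n \<Rightarrow> int) \<Rightarrow> ('n \<Rightarrow> nat) \<Rightarrow> ('n, 'n yzvar trop) coeff_seed" where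
  "trop_coeffs b d = \<lparr>yco = (\<lambda>i. trop_var (Yv i)), bmat = b, degs = d, zcf = universal_z trop_var d\<rparr>"

lemma trop_coeffs_simps [simp]:
  "yco (trop_coeffs b d) = (\<lambda>i. trop_var (Yv i))" "bmat (trop_coeffs b d) = b"
  "degs (trop_coeffs b d) = d" "zcf (trop_coeffs b d) = universal_z trop_var d"
  by (simp_all add: trop_coeffs_def)

text \<open>The tropical sum takes minima of exponents. For y_i the exponent is linear in
  \<open>s\<close>, so its minimum lies at an endpoint, \<open>0\<close> or the degree, according to
  the sign of the exponent of \<open>y\<close>. For z-variables all exponents are nonnegative and
  the constant term 1 attains \<open>0\<close>.\<close>

lemma trop_Z_at:
  assumes zcf: "(\<forall>s\<le>degs T k. zcf T k s = universal_z trop_var (degs T) k s) \<or>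
      (\<forall>s\<le>degs T k. zcf T k s = universal_z trop_var (degs T) k (degs T k - s))"
    and y: "\<And>i s. trop_lookup y (Zv i s) = 0"
  shows "trop_lookup (Z_at T k y) (Yv i) = - (int (degs T k) * [- trop_lookup y (Yv i)]\<^sub>+)"
    and "trop_lookup (Z_at T k y) (Zv i s) = 0"
proof -
  let ?d = "degs T k"
  have ends: "zcf T k 0 = 1" "zcf T k ?d = 1"
    using zcf by (auto simp: universal_z_def)
  have Y0: "trop_lookup (zcf T k s) (Yv i) = 0" if "s \<le> ?d" for s i
    using zcf that by auto
  have Zge: "trop_lookup (zcf T k s) (Zv i r) \<ge> 0" if "s \<le> ?d" for s i r
    using zcf that by auto
  show "trop_lookup (Z_at T k y) (Zv i s) = 0"
  proof (rule antisym)
    show "trop_lookup (Z_at T k y) (Zv i s) \<le> 0"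
      unfolding Z_at_def by (rule order_trans[OF trop_lookup_osum_le[of 0]]) (simp_all add: ends)
    show "0 \<le> trop_lookup (Z_at T k y) (Zv i s)"
      unfolding Z_at_def by (rule trop_lookup_osum_ge) (simp add: Zge y)
  qed
  let ?e = "trop_lookup y (Yv i)"
  show "trop_lookup (Z_at T k y) (Yv i) = - (int ?d * [- ?e]\<^sub>+)"
  proof (rule antisym)
    show "trop_lookup (Z_at T k y) (Yv i) \<le> - (int ?d * [- ?e]\<^sub>+)"
      unfolding Z_at_def
      by (rule order_trans[OF trop_lookup_osum_le[of "if ?e \<ge> 0 then 0 else ?d"]])
        (simp_all add: ends max_def)
    show "- (int ?d * [- ?e]\<^sub>+) \<le> trop_lookup (Z_at T k y) (Yv i)"
      unfolding Z_at_def
    proof (rule trop_lookup_osum_ge)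
      fix s assume "s \<le> ?d"
      have "- (int ?d * [- ?e]\<^sub>+) \<le> - (int s * [- ?e]\<^sub>+)"
        using \<open>s \<le> ?d\<close> by (simp add: mult_right_mono)
      also have "\<dots> \<le> int s * ?e"
        unfolding minus_mult_right by (rule mult_left_mono) auto
      finally show "- (int ?d * [- ?e]\<^sub>+) \<le> trop_lookup (zcf T k s * y ^ s) (Yv i)"
        using Y0 \<open>s \<le> ?d\<close> by simp
    qed
  qed
qed

lemma zcf_trop_coeffs_cases:
  "(\<forall>s\<le>d k. zcf (coeff_pattern (trop_coeffs b d) t) k s = universal_z trop_var d k s) \<or>
   (\<forall>s\<le>d k. zcf (coeff_pattern (trop_coeffs b d) t) k s = universal_z trop_var d k (d k - s))"
  using zcf_coeff_pattern_cases[of "trop_coeffs b d" k t] by (simp add: trop_coeffs_def)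

lemma trop_lookup_coeff_pattern:
  "trop_lookup (yco (coeff_pattern (trop_coeffs b d) t) j) (Yv i) = c_pattern b d t i j"
  "trop_lookup (yco (coeff_pattern (trop_coeffs b d) t) j) (Zv i s) = 0"
proof -
  have "\<forall>j. (\<forall>i. trop_lookup (yco (coeff_pattern (trop_coeffs b d) t) j) (Yv i) = c_pattern b d t i j) \<and>
    (\<forall>i s. trop_lookup (yco (coeff_pattern (trop_coeffs b d) t) j) (Zv i s) = 0)"
  proof (induction t)
    case Nil
    show ?case by (simp add: trop_coeffs_def)
  next
    case (Cons k t)
    let ?T = "coeff_pattern (trop_coeffs b d) t"
    have T: "degs ?T = d" "bmat ?T = matrix_pattern b d t" by simp_all
    have y: "trop_lookup (yco ?T k) (Zv i s) = 0" for i s using Cons.IH by simp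
    note Z = trop_Z_at[of ?T k "yco ?T k", unfolded T, OF zcf_trop_coeffs_cases y]
    show ?case
      using Cons.IH by (simp add: mutate_coeff_def T Z algebra_simps)
  qed
  then show "trop_lookup (yco (coeff_pattern (trop_coeffs b d) t) j) (Yv i) = c_pattern b d t i j"
    "trop_lookup (yco (coeff_pattern (trop_coeffs b d) t) j) (Zv i s) = 0" by simp_all
qed

lemma c_entry_eq: "c_entry b d t = c_pattern b d t"
proof (intro ext)
  fix i j
  let ?S = "\<lparr>yco = (\<lambda>i. qsf_var (Yv i)), bmat = b, degs = d, zcf = universal_z qsf_var d\<rparr>"
  have h: "semifield_hom (sf_eval trop_var)" "h 1 = 1" if "h = sf_eval trop_var" for h
    using sf_eval_hom(1) that by (auto simp: semifield_hom_def)
  have "yco (coeff_pattern (trop_coeffs b d) t) j = sf_eval trop_var (yco (coeff_pattern ?S t) j)"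
    by (rule semifield_hom_coeff_pattern[OF sf_eval_hom(1)])
      (simp_all add: trop_coeffs_def sf_eval_hom(2) universal_z_def h)
  then show "c_entry b d t i j = c_pattern b d t i j"
    by (simp add: c_entry_def Y_function_def flip: trop_lookup_coeff_pattern(1))
qed

section \<open>Recursions for X-functions and F-polynomials\<close>

text \<open>At \<open>z = z\<^sup>b\<^sup>i\<^sup>n\<close> the variables \<open>Zv i s\<close> with \<open>s > d\<^sub>i\<close> vanish and would spoil positivity.\<close>

definition yz_vars :: "('n \<Rightarrow> nat) \<Rightarrow> 'n yzvar set" where
  "yz_vars d = range Yv \<union> {Zv i s | i s. s \<le> d i}"

definition xyz_vars :: "('n \<Rightarrow> nat) \<Rightarrow> 'n xyzvar set" where
  "xyz_vars d = range Xv \<union> Cv ` yz_vars d"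

definition zeta :: "('n::linorder \<Rightarrow> 'n \<Rightarrow> int) \<Rightarrow> ('n \<Rightarrow> nat) \<Rightarrow> 'n list \<Rightarrow> 'n \<Rightarrow> nat \<Rightarrow> 'n xyzvar ratfun" where
  "zeta b d t k s = trop_to_ratfun (zcf (coeff_pattern (trop_coeffs b d) t) k s)"

lemma coeff_cluster_pattern:
  assumes "bmat S0 = bmat S" "degs S0 = degs S" "yco S0 = yco S" "zcf S0 = zcf S"
  shows "yco (cluster_pattern \<iota> S t) = yco (coeff_pattern S0 t)"
    and "zcf (cluster_pattern \<iota> S t) = zcf (coeff_pattern S0 t)"
proof -
  have "yco (cluster_pattern \<iota> S t) = yco (coeff_pattern S0 t) \<and>
    zcf (cluster_pattern \<iota> S t) = zcf (coeff_pattern S0 t)"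
    by (induction t) (simp_all add: assms mutate_def mutate_coeff_def Z_at_def cong: if_cong)
  then show "yco (cluster_pattern \<iota> S t) = yco (coeff_pattern S0 t)"
    "zcf (cluster_pattern \<iota> S t) = zcf (coeff_pattern S0 t)" by simp_all
qed

lemma rf_var_nonzero [simp]: "rf_var v \<noteq> 0"
  using subtraction_free_nonzero[OF sf_var] .

lemma trop_to_ratfun_monomial:
  fixes a :: "'n::{finite,linorder} yzvar trop"
  assumes "\<And>i s. trop_lookup a (Zv i s) = 0"
  shows "trop_to_ratfun a = monomial (\<lambda>i. rf_var (Cv (Yv i))) (\<lambda>i. trop_lookup a (Yv i))"
proof -
  have "Poly_Mapping.keys (trop_exponent a) \<subseteq> range Yv"
  proof
    fix v assume "v \<in> Poly_Mapping.keys (trop_exponent a)"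
    then show "v \<in> range Yv" using assms by (cases v) (auto simp: in_keys_iff)
  qed
  then have "trop_to_ratfun a = (\<Prod>v\<in>range Yv. rf_var (Cv v) powi trop_lookup a v)"
    unfolding trop_to_ratfun_def by (intro prod.mono_neutral_left) (auto simp: in_keys_iff)
  also have "\<dots> = monomial (\<lambda>i. rf_var (Cv (Yv i))) (\<lambda>i. trop_lookup a (Yv i))"
    unfolding monomial_def by (subst prod.reindex) (auto simp: inj_def)
  finally show ?thesis .
qed

lemma trop_to_ratfun_var: "trop_to_ratfun (trop_var v) = rf_var (Cv v)"
  by (simp add: trop_to_ratfun_def trop_var.rep_eq)

lemma trop_to_ratfun_one: "trop_to_ratfun 1 = 1"
  by (simp add: trop_to_ratfun_def one_trop.rep_eq)

text \<open>The index \<open>s'\<close> is \<open>s\<close> or \<open>d k - s\<close>, according to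
  the current orientation of Z_k. Recording only that both have the same binomial coefficient hides
  the orientation from later arguments.\<close>

lemma zeta_cases:
  assumes "s \<le> d k"
  obtains "zeta b d t k s = 1" "d k choose s = 1"
  | s' where "s' \<le> d k" "zeta b d t k s = rf_var (Cv (Zv k s'))" "d k choose s' = d k choose s"
proof -
  obtain s' where s': "s' = s \<or> s' = d k - s"
    "zcf (coeff_pattern (trop_coeffs b d) t) k s = universal_z trop_var d k s'"
    using zcf_trop_coeffs_cases[of d k b t] assms by blast
  have ch: "d k choose s' = d k choose s" using s'(1) assms binomial_symmetric by metis
  have le: "s' \<le> d k" using s'(1) assms by auto
  show thesis
  proof (cases "0 < s' \<and> s' < d k")
    case True
    then show thesis using that(2)[OF le _ ch] s'(2)
      by (simp add: zeta_def universal_z_def trop_to_ratfun_var)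
  next
    case False
    then have "s' = 0 \<or> s' = d k" using le by auto
    then have "d k choose s' = 1" by auto
    then show thesis using that(1) False s'(2) ch
      by (simp add: zeta_def universal_z_def trop_to_ratfun_one)
  qed
qed

lemma zeta_sf_in: "s \<le> d k \<Longrightarrow> sf_in (xyz_vars d) (zeta b d t k s)"
  by (rule zeta_cases[of s d k b t])
    (auto intro!: sf_in_var simp: xyz_vars_def yz_vars_def sf_in_one)

text \<open>The shape shared by the recursions below: \<open>w\<close> is the value of \<open>Z\<^sub>k\<close>, and the monomial in \<open>y\<close>
  is its tropical value.\<close>

definition cluster_step ::
  "'n::finite \<Rightarrow> nat \<Rightarrow> ('n \<Rightarrow> int) \<Rightarrow> ('n \<Rightarrow> int) \<Rightarrow> 'a::inv_monoid \<Rightarrow> ('n \<Rightarrow> 'a) \<Rightarrow> ('n \<Rightarrow> 'a) \<Rightarrow> 'n \<Rightarrow> 'a" where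
  "cluster_step k n bk ck w y x = x(k :=
     monomial x (\<lambda>i. [- bk i]\<^sub>+) ^ n * (w / monomial y (\<lambda>i. - (int n * [- ck i]\<^sub>+))) / x k)"

section \<open>X-functions and their degrees\<close>

lemma X_function_Nil: "X_function b d [] i = rf_var (Xv i)"
  by (simp add: X_function_def)

lemma X_function_Cons:
  fixes b :: "'n::{finite,linorder} \<Rightarrow> 'n \<Rightarrow> int"
  defines "yv \<equiv> \<lambda>i. rf_var (Cv (Yv i)) :: 'n xyzvar ratfun"
  shows "X_function b d (k # t) =
    cluster_step k (d k) (\<lambda>i. matrix_pattern b d t i k) (\<lambda>i. c_pattern b d t i k)
      (\<Sum>s\<le>d k. zeta b d t k s *
        (monomial yv (\<lambda>i. c_pattern b d t i k) * monomial (X_function b d t) (\<lambda>i. matrix_pattern b d t i k)) ^ s)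
      yv (X_function b d t)"
proof -
  let ?S = "\<lparr>yco = (\<lambda>i. trop_var (Yv i)), bmat = b, degs = d, zcf = universal_z trop_var d,
        xcl = (\<lambda>i. rf_var (Xv i))\<rparr> :: ('n, 'n yzvar trop, 'n xyzvar ratfun) seed"
  let ?T = "cluster_pattern trop_to_ratfun ?S t"
  let ?R = "coeff_pattern (trop_coeffs b d) t"
  have co: "yco ?T = yco ?R" "zcf ?T = zcf ?R" by (simp_all add: coeff_cluster_pattern[where ?S0.0 = "trop_coeffs b d"])
  have X: "X_function b d t = xcl ?T" "X_function b d (k # t) = xcl (mutate trop_to_ratfun k ?T)"
    by (simp_all add: X_function_def)
  have y: "trop_to_ratfun (yco ?R k) = monomial yv (\<lambda>i. c_pattern b d t i k)"
    unfolding yv_def by (subst trop_to_ratfun_monomial) (simp_all add: trop_lookup_coeff_pattern)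
  have "Z_at ?T k (yco ?T k) = Z_at ?R k (yco ?R k)"
    by (simp add: Z_at_def co)
  moreover have "trop_to_ratfun (Z_at ?R k (yco ?R k)) = monomial yv (\<lambda>i. - (int (d k) * [- c_pattern b d t i k]\<^sub>+))"
    using trop_Z_at[of ?R k "yco ?R k"] zcf_trop_coeffs_cases[of d k b t]
    unfolding yv_def
    by (subst trop_to_ratfun_monomial) (simp_all add: trop_lookup_coeff_pattern)
  ultimately show ?thesis
    unfolding X cluster_step_def
    by (simp add: mutate_def yhat_def co zeta_def y monomial_def)
qed

text \<open>Both claims go through one induction because the degree of an inverse or of a Laurent
  monomial is only available for nonzero elements, and it is positivity that keeps the X-functions
  nonzero.\<close>

lemma X_function_properties:
  fixes b :: "'n::{finite,linorder} \<Rightarrow> 'n \<Rightarrow> int"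
  assumes b: "skew_symmetrizable b"
  shows "sf_in (xyz_vars d) (X_function b d t j)"
    and "homogeneous b (\<lambda>i. g_pattern b d t i j) (X_function b d t j)"
proof -
  let ?K = "Collect (sf_in (xyz_vars d))" and ?yv = "\<lambda>i. rf_var (Cv (Yv i)) :: 'n xyzvar ratfun"
  have K: "cone ?K" by (rule cone_sf_in)
  have yvK: "?yv i \<in> ?K" for i by (auto intro!: sf_in_var simp: xyz_vars_def yz_vars_def)
  have zK: "zeta b d t k s \<in> ?K" if "s \<le> d k" for k s t
    using that by (simp add: zeta_sf_in)
  have zh: "homogeneous b (\<lambda>_. 0) (zeta b d t k s)" if "s \<le> d k" for k s t
    using that
  proof (rule zeta_cases[of s d k b t])
    show ?thesis if "zeta b d t k s = 1" using homogeneous_one that by simp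
    show ?thesis if "zeta b d t k s = rf_var (Cv (Zv k s'))" for s'
      using homogeneous_var[of b "Cv (Zv k s')"] that by simp
  qed
  have "\<forall>j. X_function b d t j \<in> ?K \<and> homogeneous b (\<lambda>i. g_pattern b d t i j) (X_function b d t j)"
  proof (induction t)
    case Nil
    have "homogeneous b (\<lambda>i. if i = j then 1 else 0) (rf_var (Xv j))" for j
      using homogeneous_var[of b "Xv j"] by simp
    then show ?case by (auto intro!: sf_in_var simp: X_function_Nil xyz_vars_def)
  next
    case (Cons k t)
    let ?X = "X_function b d t" and ?B = "matrix_pattern b d t" and ?C = "c_pattern b d t"
    let ?yh = "monomial ?yv (\<lambda>i. ?C i k) * monomial ?X (\<lambda>i. ?B i k)"
    let ?w = "\<Sum>s\<le>d k. zeta b d t k s * ?yh ^ s"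
    let ?m = "monomial ?yv (\<lambda>i. - (int (d k) * [- ?C i k]\<^sub>+))"
    let ?new = "monomial ?X (\<lambda>i. [- ?B i k]\<^sub>+) ^ d k * (?w / ?m) / ?X k"
    have XK: "?X i \<in> ?K" and Xh: "homogeneous b (\<lambda>l. g_pattern b d t l i) (?X i)" for i
      using Cons.IH by auto
    note mem = cone_mem[OF K] cone_power[OF K] cone_monomial[OF K] cone_sum_atMost[OF K]
    have newK: "?new \<in> ?K"
      by (intro mem XK yvK zK) auto
    have nz: "?X i \<noteq> 0" "?yv i \<noteq> 0" for i using mem(5)[OF XK] by auto
    have "homogeneous b (\<lambda>l. (\<Sum>i\<in>UNIV. - b l i * ?C i k) + (\<Sum>i\<in>UNIV. g_pattern b d t l i * ?B i k)) ?yh"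
      using homogeneous_var[of b "Cv (Yv _)"]
      by (intro homogeneous_mult homogeneous_monomial Xh nz) simp
    then have "homogeneous b (\<lambda>_. 0) ?yh"
      by (simp add: g_matrix_c_matrix[OF b] sum_negf)
    then have "homogeneous b (\<lambda>_. 0) (?yh ^ s)" for s
      using homogeneous_power[of b "\<lambda>_. 0" ?yh s] by simp
    then have "homogeneous b (\<lambda>_. 0) (zeta b d t k s * ?yh ^ s)" if "s \<le> d k" for s
      using homogeneous_mult[OF zh[OF that]] by fastforce
    then have wh: "homogeneous b (\<lambda>_. 0) ?w" by (intro homogeneous_sum_atMost)
    \<comment> \<open>The first minus sign belongs to the degree of y_i, the second to its exponent
      in the tropical value of Z_k.\<close>
    have "homogeneous b (\<lambda>l. \<Sum>i\<in>UNIV. - b l i * - (int (d k) * [- ?C i k]\<^sub>+)) ?m"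
      using homogeneous_var[of b "Cv (Yv _)"] by (intro homogeneous_monomial nz) simp
    then have mh: "homogeneous b (\<lambda>l. - (\<Sum>i\<in>UNIV. - b l i * - (int (d k) * [- ?C i k]\<^sub>+))) (inverse ?m)"
      by (rule homogeneous_inverse) (rule mem(5), rule mem(8), rule yvK)
    have "homogeneous b (\<lambda>l. (\<Sum>i\<in>UNIV. g_pattern b d t l i * [- ?B i k]\<^sub>+) * int (d k)
        + (0 + - (\<Sum>i\<in>UNIV. - b l i * - (int (d k) * [- ?C i k]\<^sub>+))) + - g_pattern b d t l k) ?new"
      unfolding divide_inverse
      by (intro homogeneous_mult homogeneous_power homogeneous_monomial homogeneous_inverse Xh wh mh nz)
    then have "homogeneous b (\<lambda>l. g_pattern b d (k # t) l k) ?new"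
      by (simp add: algebra_simps sum_distrib_left sum_negf)
    then show ?case
      using newK XK Xh by (simp add: X_function_Cons cluster_step_def)
  qed
  then show "sf_in (xyz_vars d) (X_function b d t j)"
    "homogeneous b (\<lambda>i. g_pattern b d t i j) (X_function b d t j)" by auto
qed

lemma g_entry_eq:
  fixes b :: "'n::{finite,linorder} \<Rightarrow> 'n \<Rightarrow> int"
  assumes b: "skew_symmetrizable b"
  shows "g_entry b d t i j = g_pattern b d t i j"
proof -
  have "X_function b d t j \<noteq> 0"
    using X_function_properties(1)[OF b] sf_in_subtraction_free subtraction_free_nonzero by blast
  then have "(THE g. homogeneous b g (X_function b d t j)) = (\<lambda>i. g_pattern b d t i j)"
    using X_function_properties(2)[OF b] homogeneous_unique by blast
  then show ?thesis by (simp add: g_entry_def)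
qed

text \<open>Apart from \<open>w\<close> the step consists of products, powers and quotients, so
  multiplicativity is enough. Addition enters only through \<open>w\<close>, whose image is computed
  in each setting separately.\<close>

lemma (in mult_hom) hom_cluster_step:
  assumes "w \<in> K" "\<And>i. y i \<in> K" "\<And>i. x i \<in> K"
  shows "(\<lambda>i. h (cluster_step k n bk ck w y x i)) = cluster_step k n bk ck (h w) (\<lambda>i. h (y i)) (\<lambda>i. h (x i))"
proof
  fix i
  show "h (cluster_step k n bk ck w y x i) = cluster_step k n bk ck (h w) (\<lambda>i. h (y i)) (\<lambda>i. h (x i)) i"
  proof (cases "i = k")
    case True
    show ?thesis
      unfolding True cluster_step_def fun_upd_same
      by (simp only: hom_divide hom_mult hom_power hom_monomial assms
          cone_mem[OF cone] cone_monomial[OF cone] cone_power[OF cone])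
  qed (simp add: cluster_step_def)
qed

section \<open>F-polynomials and their values at binomial coefficients\<close>

lemma eval_x_to_one:
  fixes d :: "'n::linorder \<Rightarrow> nat"
  shows "cone_hom (Collect (sf_in (xyz_vars d))) (rf_eval x_to_one)"
    and "sf_in (xyz_vars d) f \<Longrightarrow> sf_in (yz_vars d) (rf_eval x_to_one f)"
    and "v \<in> xyz_vars d \<Longrightarrow> rf_eval x_to_one (rf_var v) = x_to_one v"
proof -
  have \<sigma>: "x_to_one v \<in> Collect (sf_in (yz_vars d))" if "v \<in> xyz_vars d" for v
    using that by (cases v) (auto simp: xyz_vars_def intro: sf_in_one sf_in_var)
  note ev = cone_hom_rf_eval[of "Collect (sf_in (yz_vars d))" "xyz_vars d" x_to_one, OF cone_sf_in \<sigma>]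
  show "cone_hom (Collect (sf_in (xyz_vars d))) (rf_eval (x_to_one :: _ \<Rightarrow> 'n yzvar ratfun))"
    by (rule ev(1))
  show "sf_in (xyz_vars d) f \<Longrightarrow> sf_in (yz_vars d) (rf_eval x_to_one f)"
    using ev(2)[of f] by simp
  show "v \<in> xyz_vars d \<Longrightarrow> rf_eval x_to_one (rf_var v) = x_to_one v"
    by (rule ev(3))
qed

lemma F_polynomial_properties:
  fixes b :: "'n::{finite,linorder} \<Rightarrow> 'n \<Rightarrow> int"
  assumes b: "skew_symmetrizable b"
  shows "sf_in (yz_vars d) (F_polynomial b d t j)"
    and "F_polynomial b d [] j = 1"
    and "F_polynomial b d (k # t) =
    cluster_step k (d k) (\<lambda>i. matrix_pattern b d t i k) (\<lambda>i. c_pattern b d t i k)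
      (\<Sum>s\<le>d k. rf_eval x_to_one (zeta b d t k s) *
        (monomial (\<lambda>i. rf_var (Yv i)) (\<lambda>i. c_pattern b d t i k)
          * monomial (F_polynomial b d t) (\<lambda>i. matrix_pattern b d t i k)) ^ s)
      (\<lambda>i. rf_var (Yv i)) (F_polynomial b d t)"
proof -
  let ?V = "xyz_vars d"
  let ?K = "Collect (sf_in ?V)" and ?yv = "\<lambda>i. rf_var (Cv (Yv i)) :: 'n xyzvar ratfun"
  interpret cone_hom ?K "rf_eval x_to_one" by (rule eval_x_to_one(1))
  show "sf_in (yz_vars d) (F_polynomial b d t j)"
    unfolding F_polynomial_def by (rule eval_x_to_one(2)[OF X_function_properties(1)[OF b]])
  have "rf_eval x_to_one (rf_var v) = x_to_one v" if "v \<in> ?V" for v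
    using eval_x_to_one(3) that .
  then have var: "rf_eval x_to_one (rf_var (Xv i)) = 1" "rf_eval x_to_one (?yv i) = rf_var (Yv i)" for i
    by (simp_all add: xyz_vars_def yz_vars_def)
  show "F_polynomial b d [] j = 1"
    by (simp add: F_polynomial_def X_function_Nil var)
  have XK: "X_function b d t i \<in> ?K" for i using X_function_properties(1)[OF b] by simp
  have yvK: "?yv i \<in> ?K" for i by (auto intro!: sf_in_var simp: xyz_vars_def yz_vars_def)
  have zK: "zeta b d t k s \<in> ?K" if "s \<le> d k" for s
    using that by (simp add: zeta_sf_in)
  note mem = cone_mem[OF cone] cone_power[OF cone] cone_monomial[OF cone] cone_sum_atMost[OF cone]
  let ?yh = "monomial ?yv (\<lambda>i. c_pattern b d t i k) * monomial (X_function b d t) (\<lambda>i. matrix_pattern b d t i k)"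
  let ?w = "\<Sum>s\<le>d k. zeta b d t k s * ?yh ^ s"
  have yhK: "?yh \<in> ?K" by (intro mem XK yvK)
  have F: "F_polynomial b d t' = (\<lambda>j. rf_eval x_to_one (X_function b d t' j))" for t'
    by (simp add: F_polynomial_def fun_eq_iff)
  have w: "?w \<in> ?K" by (intro mem zK yhK)
  have hw: "rf_eval x_to_one ?w = (\<Sum>s\<le>d k. rf_eval x_to_one (zeta b d t k s) *
        (monomial (\<lambda>i. rf_var (Yv i)) (\<lambda>i. c_pattern b d t i k)
          * monomial (F_polynomial b d t) (\<lambda>i. matrix_pattern b d t i k)) ^ s)"
  proof -
    have yh: "rf_eval x_to_one ?yh = monomial (\<lambda>i. rf_var (Yv i)) (\<lambda>i. c_pattern b d t i k)
          * monomial (F_polynomial b d t) (\<lambda>i. matrix_pattern b d t i k)"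
      by (simp only: hom_mult hom_monomial mem XK yvK var F)
    have "rf_eval x_to_one ?w = (\<Sum>s\<le>d k. rf_eval x_to_one (zeta b d t k s * ?yh ^ s))"
      by (rule hom_sum_atMost) (intro mem zK yhK)
    also have "\<dots> = (\<Sum>s\<le>d k. rf_eval x_to_one (zeta b d t k s) * rf_eval x_to_one ?yh ^ s)"
      by (rule sum.cong) (simp_all only: hom_mult[OF zK mem(7)[OF yhK]] hom_power[OF yhK] atMost_iff)
    finally show ?thesis unfolding yh .
  qed
  show "F_polynomial b d (k # t) =
    cluster_step k (d k) (\<lambda>i. matrix_pattern b d t i k) (\<lambda>i. c_pattern b d t i k)
      (\<Sum>s\<le>d k. rf_eval x_to_one (zeta b d t k s) *
        (monomial (\<lambda>i. rf_var (Yv i)) (\<lambda>i. c_pattern b d t i k)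
          * monomial (F_polynomial b d t) (\<lambda>i. matrix_pattern b d t i k)) ^ s)
      (\<lambda>i. rf_var (Yv i)) (F_polynomial b d t)"
    unfolding F[of "k # t"] X_function_Cons hom_cluster_step[OF w yvK XK] hw
    by (simp add: var F)
qed

text \<open>The point and the cone are left general because two instances are used: the variables of
  Q(y) with the subtraction-free functions, which leads to the semifield, and yhat with a positive
  cone of the ambient field.\<close>

lemma F_polynomial_binomial:
  fixes b :: "'n::{finite,linorder} \<Rightarrow> 'n \<Rightarrow> int" and d :: "'n \<Rightarrow> nat" and y :: "'n \<Rightarrow> 'f::field"
  assumes b: "skew_symmetrizable b" and L: "cone L" and y: "\<And>i. y i \<in> L"
  defines "f \<equiv> \<lambda>t j. rf_eval (bin_point d y) (F_polynomial b d t j)"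
  shows "f t j \<in> L"
    and "f [] j = 1"
    and "f (k # t) = cluster_step k (d k) (\<lambda>i. matrix_pattern b d t i k) (\<lambda>i. c_pattern b d t i k)
      ((1 + monomial y (\<lambda>i. c_pattern b d t i k) * monomial (f t) (\<lambda>i. matrix_pattern b d t i k)) ^ d k) y (f t)"
proof -
  let ?V = "yz_vars d" and ?e = "rf_eval (bin_point d y)"
  let ?K = "Collect (sf_in ?V)" and ?yv = "\<lambda>i. rf_var (Yv i) :: 'n yzvar ratfun"
  have \<sigma>: "bin_point d y v \<in> L" if "v \<in> ?V" for v
    using that y by (cases v) (auto simp: yz_vars_def intro!: cone_of_nat[OF L])
  note ev = cone_hom_rf_eval[of L ?V "bin_point d y", OF L \<sigma>]
  interpret cone_hom ?K ?e by (rule ev(1))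
  show "f t j \<in> L"
    unfolding f_def by (rule ev(2)) (simp_all add: F_polynomial_properties(1)[OF b])
  show "f [] j = 1"
    by (simp add: f_def F_polynomial_properties(2)[OF b] hom_one)
  have var: "?e (rf_var v) = bin_point d y v" if "v \<in> ?V" for v using ev(3) that by blast
  have FK: "F_polynomial b d t i \<in> ?K" for i using F_polynomial_properties(1)[OF b] by simp
  have yvK: "?yv i \<in> ?K" for i by (auto intro!: sf_in_var simp: yz_vars_def)
  have z: "rf_eval x_to_one (zeta b d t k s) \<in> ?K \<and>
      ?e (rf_eval x_to_one (zeta b d t k s)) = of_nat (d k choose s)" if "s \<le> d k" for s
  proof -
    show ?thesis
      using that
    proof (rule zeta_cases[of s d k b t])
      assume "zeta b d t k s = 1" "d k choose s = 1"
      moreover have "rf_eval (x_to_one :: 'n xyzvar \<Rightarrow> 'n yzvar ratfun) 1 = 1"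
        using mult_hom.hom_one[OF cone_hom.axioms(1)[OF eval_x_to_one(1)]] by blast
      ultimately show ?thesis by (simp add: hom_one sf_in_one)
    next
      fix s' assume *: "s' \<le> d k" "zeta b d t k s = rf_var (Cv (Zv k s'))" "d k choose s' = d k choose s"
      then have V: "Zv k s' \<in> ?V" "Cv (Zv k s') \<in> xyz_vars d" by (auto simp: yz_vars_def xyz_vars_def)
      then have "rf_eval x_to_one (zeta b d t k s) = rf_var (Zv k s')"
        using eval_x_to_one(3)[of "Cv (Zv k s')"] *(2) by simp
      then show ?thesis using var[OF V(1)] *(3) V(1) by (simp add: sf_in_var)
    qed
  qed
  note mem = cone_mem[OF cone] cone_power[OF cone] cone_monomial[OF cone] cone_sum_atMost[OF cone]
  let ?yh = "monomial ?yv (\<lambda>i. c_pattern b d t i k) * monomial (F_polynomial b d t) (\<lambda>i. matrix_pattern b d t i k)"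
  let ?yh' = "monomial y (\<lambda>i. c_pattern b d t i k) * monomial (f t) (\<lambda>i. matrix_pattern b d t i k)"
  let ?w = "\<Sum>s\<le>d k. rf_eval x_to_one (zeta b d t k s) * ?yh ^ s"
  have yhK: "?yh \<in> ?K" by (intro mem FK yvK)
  have e_yv: "?e (?yv i) = y i" for i by (simp add: var yz_vars_def)
  have f: "f t' = (\<lambda>j. ?e (F_polynomial b d t' j))" for t' by (simp add: f_def)
  have zK: "rf_eval x_to_one (zeta b d t k s) \<in> ?K" if "s \<le> d k" for s using z[OF that] ..
  have w: "?w \<in> ?K" by (intro mem zK yhK)
  have yh: "?e ?yh = ?yh'" by (simp only: hom_mult hom_monomial mem FK yvK e_yv f)
  have "?e ?w = (\<Sum>s\<le>d k. ?e (rf_eval x_to_one (zeta b d t k s) * ?yh ^ s))"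
    by (rule hom_sum_atMost) (intro mem zK yhK)
  also have "\<dots> = (\<Sum>s\<le>d k. of_nat (d k choose s) * ?yh' ^ s)"
    by (rule sum.cong)
      (simp_all only: hom_mult[OF zK mem(7)[OF yhK]] hom_power[OF yhK] yh z[THEN conjunct2] atMost_iff)
  also have "\<dots> = (1 + ?yh') ^ d k"
    using binomial_ring[of ?yh' 1 "d k"] by (simp add: add.commute)
  finally have hw: "?e ?w = (1 + ?yh') ^ d k" .
  show "f (k # t) = cluster_step k (d k) (\<lambda>i. matrix_pattern b d t i k) (\<lambda>i. c_pattern b d t i k)
      ((1 + ?yh') ^ d k) y (f t)"
    unfolding f[of "k # t"] F_polynomial_properties(3)[OF b] hom_cluster_step[OF w yvK FK] hw
    by (simp add: e_yv f)
qed

section \<open>Binomial specialization\<close>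

lemma mult_hom_sf_eval: "mult_hom (Collect subtraction_free) (\<lambda>f. sf_eval y (Abs_qsf f))"
  and sf_eval_Abs_add: "subtraction_free f \<Longrightarrow> subtraction_free g \<Longrightarrow>
    sf_eval y (Abs_qsf (f + g)) = sf_eval y (Abs_qsf f) \<oplus> sf_eval y (Abs_qsf g)"
  and sf_eval_Abs_var: "sf_eval y (Abs_qsf (rf_var v)) = y v"
proof -
  have h: "sf_eval y 1 = 1" "\<And>a b. sf_eval y (a * b) = sf_eval y a * sf_eval y b"
    "\<And>a b. sf_eval y (a \<oplus> b) = sf_eval y a \<oplus> sf_eval y b"
    using sf_eval_hom(1)[of y] by (auto simp: semifield_hom_def)
  show "mult_hom (Collect subtraction_free) (\<lambda>f. sf_eval y (Abs_qsf f))"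
  proof
    show "sf_eval y (Abs_qsf 1) = 1" using h(1) by (simp add: one_qsf_def)
    show "sf_eval y (Abs_qsf (f * g)) = sf_eval y (Abs_qsf f) * sf_eval y (Abs_qsf g)"
      if "f \<in> Collect subtraction_free" "g \<in> Collect subtraction_free" for f g
      using that by (simp add: times_qsf.abs_eq eq_onp_def flip: h(2))
  qed (rule cone_subtraction_free)
  show "sf_eval y (Abs_qsf (f + g)) = sf_eval y (Abs_qsf f) \<oplus> sf_eval y (Abs_qsf g)"
    if "subtraction_free f" "subtraction_free g"
    using that by (simp add: oplus_qsf.abs_eq eq_onp_def flip: h(3))
  show "sf_eval y (Abs_qsf (rf_var v)) = y v"
    using sf_eval_hom(2)[of y v] by (simp add: qsf_var_def)
qed

text \<open>The binomial theorem has already been applied in Q(y), so the value of Z_k arrives as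
  \<open>(1 + u) ^ n\<close> and multiplicativity turns it into \<open>(1 \<oplus> u) ^ n\<close>;
  the binomial coefficients need no separate evaluation in the semifield.\<close>

lemma F_bin_P_pattern:
  fixes S :: "('n::{finite,linorder}, 'p::semifield, 'm) coeff_seed_scheme"
  assumes b: "skew_symmetrizable (bmat S)"
  shows "F_bin_P S [] j = 1"
    and "F_bin_P S (k # t) = cluster_step k (degs S k)
      (\<lambda>i. matrix_pattern (bmat S) (degs S) t i k) (\<lambda>i. c_pattern (bmat S) (degs S) t i k)
      ((1 \<oplus> monomial (yco S) (\<lambda>i. c_pattern (bmat S) (degs S) t i k)
        * monomial (F_bin_P S t) (\<lambda>i. matrix_pattern (bmat S) (degs S) t i k)) ^ degs S k) (yco S) (F_bin_P S t)"
proof -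
  let ?h = "\<lambda>f. sf_eval (yco S) (Abs_qsf f)" and ?K = "Collect subtraction_free"
  let ?B = "matrix_pattern (bmat S) (degs S) t" and ?C = "c_pattern (bmat S) (degs S) t"
  let ?F = "\<lambda>t j. rf_eval (bin_point (degs S) rf_var) (F_polynomial (bmat S) (degs S) t j)"
  interpret mult_hom ?K ?h by (rule mult_hom_sf_eval)
  have yK: "rf_var i \<in> ?K" for i using sf_var by simp
  note F = F_polynomial_binomial[where y = rf_var and d = "degs S", OF b cone yK]
  have FK: "?F t i \<in> ?K" for i by (rule F(1))
  have \<phi>: "F_bin_P S t = (\<lambda>j. ?h (?F t j))" for t
    by (simp add: F_bin_P_def F_bin_sf_def fun_eq_iff)
  show "F_bin_P S [] j = 1" by (simp add: \<phi> F(2) hom_one)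
  let ?yh = "monomial rf_var (\<lambda>i. ?C i k) * monomial (?F t) (\<lambda>i. ?B i k)"
  have yhK: "?yh \<in> ?K" by (intro cone_mem[OF cone] cone_monomial[OF cone] FK yK)
  have w: "(1 + ?yh) ^ degs S k \<in> ?K" by (intro cone_power[OF cone] cone_mem[OF cone] yhK)
  have "?h ((1 + ?yh) ^ degs S k) = (1 \<oplus> ?h ?yh) ^ degs S k"
    using yhK by (subst hom_power) (auto simp: sf_eval_Abs_add sf_one hom_one intro: subtraction_free.intros)
  also have "?h ?yh = monomial (yco S) (\<lambda>i. ?C i k) * monomial (F_bin_P S t) (\<lambda>i. ?B i k)"
    by (simp only: hom_mult hom_monomial cone_monomial[OF cone] FK yK sf_eval_Abs_var \<phi>)
  finally show "F_bin_P S (k # t) = cluster_step k (degs S k) (\<lambda>i. ?B i k) (\<lambda>i. ?C i k)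
      ((1 \<oplus> monomial (yco S) (\<lambda>i. ?C i k) * monomial (F_bin_P S t) (\<lambda>i. ?B i k)) ^ degs S k) (yco S) (F_bin_P S t)"
    unfolding \<phi>[of "k # t"] fun_cong[OF F(3)] hom_cluster_step[OF w yK FK]
    by (simp add: sf_eval_Abs_var \<phi>)
qed

text \<open>The products \<open>Y j\<close> obey coefficient mutation with \<open>w ^ d k\<close> as
  the value of Z_k. In the y-exponents the tropical monomial, raised to \<open>- B k j\<close>,
  removes the \<open>[- C i k]_+\<close> term of the c-vector recursion; in the x-exponents the
  monomial with \<open>[- B i k]_+\<close> combines with the mutated matrix.\<close>

lemma cluster_step_coefficients:
  fixes x y :: "'n::finite \<Rightarrow> 'a::inv_monoid" and B C :: "'n \<Rightarrow> 'n \<Rightarrow> int" and d :: "'n \<Rightarrow> nat"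
  assumes inv: "\<And>i. invertible (y i)" "\<And>i. invertible (x i)" "invertible w" and B: "B k k = 0"
  defines "Y \<equiv> \<lambda>j. monomial y (\<lambda>i. C i j) * monomial x (\<lambda>i. B i j)"
    and "x' \<equiv> cluster_step k (d k) (\<lambda>i. B i k) (\<lambda>i. C i k) (w ^ d k) y x"
  shows "monomial y (\<lambda>i. - C i k) * monomial x' (\<lambda>i. mutate_matrix d k B i k) = inverse (Y k)"
    and "j \<noteq> k \<Longrightarrow>
      monomial y (\<lambda>i. C i j + C i k * int (d k) * [B k j]\<^sub>+ + B k j * int (d k) * [- C i k]\<^sub>+)
        * monomial x' (\<lambda>i. mutate_matrix d k B i j)
      = Y j * (Y k ^ d k) powi [B k j]\<^sub>+ * w powi (- (int (d k) * B k j))"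
proof -
  note invm = invertible_monomial[OF inv(1)] invertible_monomial[OF inv(2)]
  have neg: "monomial u (\<lambda>i. - e i) = inverse (monomial u e)" if "\<And>i. invertible (u i)" for u :: "'n \<Rightarrow> 'a" and e
    using monomial_scale[where u = u and e = e and n = "- 1"] that inverse_powi[OF invertible_monomial, of u e 1] by simp
  have "monomial x' (\<lambda>i. mutate_matrix d k B i k) = monomial x (\<lambda>i. - B i k)"
    unfolding x'_def cluster_step_def by (subst monomial_update) (simp_all add: mutate_matrix_def B)
  then show "monomial y (\<lambda>i. - C i k) * monomial x' (\<lambda>i. mutate_matrix d k B i k) = inverse (Y k)"
    by (simp add: Y_def neg inv invertible_mult invm)
  assume j: "j \<noteq> k"
  let ?n = "int (d k)"
  let ?v = "monomial x (\<lambda>i. [- B i k]\<^sub>+) ^ d k * (w ^ d k / monomial y (\<lambda>i. - (?n * [- C i k]\<^sub>+))) / x k"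
  \<comment> \<open>The new variable as a Laurent monomial in \<open>x\<close>, \<open>w\<close> and
    \<open>y\<close>; the exponent \<open>- 1\<close> at \<open>k\<close> is the division by the old
    variable.\<close>
  have v: "?v = monomial x (\<lambda>i. [- B i k]\<^sub>+ * ?n + (if i = k then - 1 else 0)) * w powi ?n * monomial y (\<lambda>i. [- C i k]\<^sub>+ * ?n)"
  proof -
    have 1: "monomial x (\<lambda>i. [- B i k]\<^sub>+) ^ d k = monomial x (\<lambda>i. [- B i k]\<^sub>+ * ?n)"
      by (simp add: monomial_scale inv)
    have 2: "inverse (monomial y (\<lambda>i. - (?n * [- C i k]\<^sub>+))) = monomial y (\<lambda>i. [- C i k]\<^sub>+ * ?n)"
      using neg[where u = y and e = "\<lambda>i. - (?n * [- C i k]\<^sub>+)", OF inv(1)] by (simp add: mult.commute)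
    have 3: "inverse (x k) = monomial x (\<lambda>i. if i = k then - 1 else 0)"
      by (simp add: monomial_unit)
    have 4: "w powi ?n = w ^ d k" by simp
    show ?thesis
      unfolding divide_eq_times_inverse 1 2 3 4 monomial_add[OF inv(2)] by (simp only: ac_simps)
  qed
  have vi: "invertible ?v"
    unfolding v by (intro invertible_mult invm invertible_powi inv)
  have vp: "?v powi - B k j = monomial x (\<lambda>i. ([- B i k]\<^sub>+ * ?n + (if i = k then - 1 else 0)) * - B k j)
      * w powi (?n * - B k j) * monomial y (\<lambda>i. [- C i k]\<^sub>+ * ?n * - B k j)"
    unfolding v by (simp only: mult_powi invertible_mult invm invertible_powi inv monomial_scale powi_mult)
  have Yk: "(Y k ^ d k) powi [B k j]\<^sub>+ = monomial y (\<lambda>i. C i k * (?n * [B k j]\<^sub>+)) * monomial x (\<lambda>i. B i k * (?n * [B k j]\<^sub>+))"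
  proof -
    have "(Y k ^ d k) powi [B k j]\<^sub>+ = Y k powi (?n * [B k j]\<^sub>+)"
      unfolding Y_def by (simp add: powi_mult invertible_mult invm)
    then show ?thesis unfolding Y_def by (simp only: mult_powi invm monomial_scale inv)
  qed
  let ?b = "\<lambda>i. mutate_matrix d k B i j"
  \<comment> \<open>Only the entry at \<open>k\<close> has changed, and its exponent in the mutated
    column is \<open>- B k j\<close>; it is split off.\<close>
  have "monomial x' ?b = monomial x (?b(k := 0)) * ?v powi - B k j"
    unfolding x'_def cluster_step_def
    by (subst monomial_update'[OF inv(2) vi]) (simp add: mutate_matrix_def)
  then have "monomial y (\<lambda>i. C i j + C i k * ?n * [B k j]\<^sub>+ + B k j * ?n * [- C i k]\<^sub>+) * monomial x' ?b
    = (monomial y (\<lambda>i. C i j + C i k * ?n * [B k j]\<^sub>+ + B k j * ?n * [- C i k]\<^sub>+)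
        * monomial y (\<lambda>i. [- C i k]\<^sub>+ * ?n * - B k j))
      * (monomial x (?b(k := 0)) * monomial x (\<lambda>i. ([- B i k]\<^sub>+ * ?n + (if i = k then - 1 else 0)) * - B k j))
      * w powi (?n * - B k j)"
    unfolding vp by (simp only: ac_simps)
  also have "\<dots> = monomial y (\<lambda>i. C i j + C i k * (?n * [B k j]\<^sub>+))
      * monomial x (\<lambda>i. B i j + B i k * (?n * [B k j]\<^sub>+)) * w powi (?n * - B k j)"
  proof -
    have 1: "(\<lambda>i. C i j + C i k * ?n * [B k j]\<^sub>+ + B k j * ?n * [- C i k]\<^sub>+ + [- C i k]\<^sub>+ * ?n * - B k j)
      = (\<lambda>i. C i j + C i k * (?n * [B k j]\<^sub>+))"
      by (simp add: algebra_simps)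
    have 2: "(\<lambda>i. (?b(k := 0)) i + ([- B i k]\<^sub>+ * ?n + (if i = k then - 1 else 0)) * - B k j)
      = (\<lambda>i. B i j + B i k * (?n * [B k j]\<^sub>+))"
    proof
      fix i
      have p: "[B i k]\<^sub>+ = B i k + [- B i k]\<^sub>+" "[B k j]\<^sub>+ = B k j + [- B k j]\<^sub>+"
        using pos_part_diff[of "B i k"] pos_part_diff[of "B k j"] by linarith+
      show "(?b(k := 0)) i + ([- B i k]\<^sub>+ * ?n + (if i = k then - 1 else 0)) * - B k j
        = B i j + B i k * (?n * [B k j]\<^sub>+)"
      \<comment> \<open>At \<open>i = k\<close> the mutated entry has been replaced by
        \<open>0\<close>, and the \<open>- 1\<close> from the division restores
        \<open>B k j\<close>, since \<open>B k k\<close> is \<open>0\<close>.\<close>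
      proof (cases "i = k")
        case True then show ?thesis by (simp add: B)
      next
        case False
        then show ?thesis
          using j arg_cong[OF p(1), of "\<lambda>z. z * (?n * B k j)"] arg_cong[OF p(2), of "\<lambda>z. B i k * ?n * z"]
          by (simp add: mutate_matrix_def algebra_simps)
      qed
    qed
    show ?thesis by (simp only: inv 1 2 flip: monomial_add)
  qed
  also have "\<dots> = Y j * (Y k ^ d k) powi [B k j]\<^sub>+ * w powi (- (?n * B k j))"
    unfolding Yk by (simp add: Y_def monomial_add inv ac_simps)
  finally show "monomial y (\<lambda>i. C i j + C i k * ?n * [B k j]\<^sub>+ + B k j * ?n * [- C i k]\<^sub>+) * monomial x' ?b
    = Y j * (Y k ^ d k) powi [B k j]\<^sub>+ * w powi (- (?n * B k j))" .
qed

section \<open>Mutation of the specialized coefficients\<close>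

lemma y_bin_eq:
  "y_bin S t j = monomial (yco S) (\<lambda>i. c_pattern (bmat S) (degs S) t i j)
     * monomial (F_bin_P S t) (\<lambda>i. matrix_pattern (bmat S) (degs S) t i j)"
  by (simp add: y_bin_def c_entry_eq monomial_def)

lemma y_bin_Nil: "skew_symmetrizable (bmat S) \<Longrightarrow> y_bin S [] j = yco S j"
  by (simp add: y_bin_eq F_bin_P_pattern(1) monomial_unit) (simp add: monomial_def F_bin_P_pattern(1))

text \<open>The argument of Z_k in the recursion for \<open>F_bin_P\<close> is
  \<open>y_bin S t k\<close> itself, so \<open>w\<close> is \<open>1 \<oplus> y_bin S t k\<close>
  and the recursion closes.\<close>

lemma y_bin_Cons:
  fixes S :: "('n::{finite,linorder}, 'p::semifield, 'm) coeff_seed_scheme" and t k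
  assumes b: "skew_symmetrizable (bmat S)"
  defines "bk \<equiv> matrix_pattern (bmat S) (degs S) t k"
  shows "y_bin S (k # t) j = (if j = k then inverse (y_bin S t k)
    else y_bin S t j * (y_bin S t k ^ degs S k) powi [bk j]\<^sub>+
      * (1 \<oplus> y_bin S t k) powi (- (int (degs S k) * bk j)))"
proof -
  have kk: "matrix_pattern (bmat S) (degs S) t k k = 0"
    by (rule skew_symmetrizable_diag[OF skew_symmetrizable_matrix_pattern[OF b]])
  show ?thesis
    using cluster_step_coefficients[where y = "yco S" and x = "F_bin_P S t" and w = "1 \<oplus> y_bin S t k"
        and B = "matrix_pattern (bmat S) (degs S) t" and k = k and C = "c_pattern (bmat S) (degs S) t"
        and d = "degs S", OF _ _ _ kk]
    by (cases "j = k") (simp_all add: y_bin_eq F_bin_P_pattern(2)[OF b] bk_def)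
qed

section \<open>Mutation of the specialized cluster variables\<close>

lemma monomial_divide_base:
  fixes u v :: "'n::finite \<Rightarrow> 'f::field"
  shows "monomial (\<lambda>i. u i / v i) e = monomial u e / monomial v e"
  by (simp add: monomial_def power_int_divide_distrib prod_dividef)

definition F_bin_yhat ::
  "('p \<Rightarrow> 'f::field) \<Rightarrow> ('n::{finite,linorder}, 'p, 'f) seed \<Rightarrow> 'n list \<Rightarrow> 'n \<Rightarrow> 'f" where
  "F_bin_yhat \<iota> S t j = rf_eval (bin_point (degs S) (yhat \<iota> S)) (F_polynomial (bmat S) (degs S) t j)"

locale binomial_specialization =
  fixes \<iota> :: "'p::semifield \<Rightarrow> 'f::field" and S :: "('n::{finite,linorder}, 'p, 'f) seed"
  assumes seed: "generalized_seed \<iota> S"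
begin

abbreviation "b \<equiv> bmat S"
abbreviation "d \<equiv> degs S"
abbreviation "x \<equiv> xcl S"
abbreviation "y \<equiv> yco S"
abbreviation "B \<equiv> matrix_pattern b d"
abbreviation "C \<equiv> c_pattern b d"
abbreviation "G \<equiv> g_pattern b d"
abbreviation "\<phi> \<equiv> F_bin_P S"
abbreviation "f \<equiv> F_bin_yhat \<iota> S"

lemma skew_b: "skew_symmetrizable b"
  using seed by (simp add: generalized_seed_def)

lemma iota_one: "\<iota> 1 = 1" and iota_mult: "\<iota> (p * q) = \<iota> p * \<iota> q"
  using seed by (simp_all add: generalized_seed_def group_ring_embedding_def)

lemma iota_inverse: "\<iota> (inverse p) = inverse (\<iota> p)"
proof -
  have "\<iota> p * \<iota> (inverse p) = 1"
    by (metis iota_one iota_mult sf_left_inverse mult.commute)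
  then show ?thesis using inverse_unique by metis
qed

lemma iota_nonzero: "\<iota> p \<noteq> 0"
  by (metis iota_one iota_mult sf_left_inverse mult_zero_right zero_neq_one)

lemma iota_power: "\<iota> (p ^ n) = \<iota> p ^ n"
  by (induction n) (simp_all add: iota_one iota_mult)

lemma iota_powi: "\<iota> (p powi n) = \<iota> p powi n"
  by (simp add: power_int_def iota_power iota_inverse)

lemma iota_divide: "\<iota> (p / q) = \<iota> p / \<iota> q"
  by (simp add: sf_divide iota_mult iota_inverse divide_inverse)

lemma iota_monomial: "\<iota> (monomial u e) = monomial (\<lambda>i. \<iota> (u i)) e"
proof -
  have "\<iota> (\<Prod>i\<in>A. u i powi e i) = (\<Prod>i\<in>A. \<iota> (u i) powi e i)" for A
    by (induction A rule: infinite_finite_induct) (simp_all add: iota_one iota_mult iota_powi)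
  then show ?thesis by (simp add: monomial_def)
qed

lemma cone_values:
  obtains L where "cone L" "\<And>p. \<iota> p \<in> L" "\<And>i. x i \<in> L" "\<And>i. yhat \<iota> S i \<in> L"
proof -
  obtain L where L: "cone L" "\<And>p. \<iota> p \<in> L" "\<And>i. x i \<in> L"
    using positive_cone_exists[of \<iota> x] seed by (auto simp: generalized_seed_def)
  have "yhat \<iota> S i \<in> L" for i
    unfolding yhat_def by (intro cone_mem[OF L(1)] cone_prod cone_powi L)
  with L show thesis by (rule that)
qed

lemma x_nonzero: "x i \<noteq> 0" and f_nonzero: "f t i \<noteq> 0"
proof -
  obtain L where L: "cone L" "\<And>p. \<iota> p \<in> L" "\<And>i. x i \<in> L" "\<And>i. yhat \<iota> S i \<in> L"
    using cone_values by blast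
  show "x i \<noteq> 0" using cone_mem(5)[OF L(1)] L(3) by auto
  show "f t i \<noteq> 0" using cone_mem(5)[OF L(1) F_polynomial_binomial(1)[OF skew_b L(1,4)]] by (simp add: F_bin_yhat_def)
qed

lemma f_Nil: "f [] i = 1"
  and f_Cons: "f (k # t) = cluster_step k (d k) (\<lambda>i. B t i k) (\<lambda>i. C t i k)
      ((1 + monomial (yhat \<iota> S) (\<lambda>i. C t i k) * monomial (f t) (\<lambda>i. B t i k)) ^ d k) (yhat \<iota> S) (f t)"
proof -
  obtain L where "cone L" "\<And>p. \<iota> p \<in> L" "\<And>i. x i \<in> L" "\<And>i. yhat \<iota> S i \<in> L"
    using cone_values by blast
  note L = this(1,4)
  show "f [] i = 1" using F_polynomial_binomial(2)[OF skew_b L] by (simp add: F_bin_yhat_def)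
  show "f (k # t) = cluster_step k (d k) (\<lambda>i. B t i k) (\<lambda>i. C t i k)
      ((1 + monomial (yhat \<iota> S) (\<lambda>i. C t i k) * monomial (f t) (\<lambda>i. B t i k)) ^ d k) (yhat \<iota> S) (f t)"
    using F_polynomial_binomial(3)[OF skew_b L] by (simp add: F_bin_yhat_def[abs_def])
qed

lemma x_bin_eq: "x_bin \<iota> S t i = monomial x (\<lambda>l. G t l i) * (f t i / \<iota> (\<phi> t i))"
  by (simp add: x_bin_def F_bin_yhat_def monomial_def g_entry_eq[OF skew_b])

lemma monomial_x_bin:
  "monomial (x_bin \<iota> S t) e
    = monomial x (\<lambda>l. \<Sum>i\<in>UNIV. G t l i * e i) * (monomial (f t) e / monomial (\<lambda>i. \<iota> (\<phi> t i)) e)"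
proof -
  have "x_bin \<iota> S t = (\<lambda>i. monomial x (\<lambda>l. G t l i) * (f t i / \<iota> (\<phi> t i)))"
    by (rule ext) (rule x_bin_eq)
  then have "monomial (x_bin \<iota> S t) e = monomial (\<lambda>i. monomial x (\<lambda>l. G t l i) * (f t i / \<iota> (\<phi> t i))) e"
    by simp
  also have "\<dots> = monomial (\<lambda>i. monomial x (\<lambda>l. G t l i)) e * monomial (\<lambda>i. f t i / \<iota> (\<phi> t i)) e"
    using invertible_monomial[of x] x_nonzero f_nonzero iota_nonzero
    by (intro monomial_mult_base) auto
  also have "monomial (\<lambda>i. monomial x (\<lambda>l. G t l i)) e = monomial x (\<lambda>l. \<Sum>i\<in>UNIV. G t l i * e i)"
    by (rule monomial_compose) (simp add: x_nonzero)
  finally show ?thesis by (simp add: monomial_divide_base)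
qed

lemma monomial_yhat:
  "monomial (yhat \<iota> S) e = monomial (\<lambda>i. \<iota> (y i)) e * monomial x (\<lambda>l. \<Sum>i\<in>UNIV. b l i * e i)"
proof -
  have "monomial (yhat \<iota> S) e = monomial (\<lambda>i. \<iota> (y i) * monomial x (\<lambda>l. b l i)) e"
    by (simp add: yhat_def[abs_def] monomial_def[of x])
  also have "\<dots> = monomial (\<lambda>i. \<iota> (y i)) e * monomial (\<lambda>i. monomial x (\<lambda>l. b l i)) e"
    using invertible_monomial[of x] x_nonzero iota_nonzero by (intro monomial_mult_base) auto
  finally show ?thesis by (simp add: monomial_compose x_nonzero)
qed

text \<open>Identifies the argument of Z_k in the F-recursion with the yhat of the specialized seed
  at \<open>t\<close>. The values in the semifield enter \<open>y_bin\<close> and the monomial in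
  \<open>x_bin\<close> with opposite exponents and cancel; the x-exponents agree by
  \<open>g_matrix_c_matrix\<close>.\<close>

lemma yhat_pattern:
  "\<iota> (y_bin S t k) * monomial (x_bin \<iota> S t) (\<lambda>i. B t i k)
    = monomial (yhat \<iota> S) (\<lambda>i. C t i k) * monomial (f t) (\<lambda>i. B t i k)"
proof -
  have "monomial (\<lambda>i. \<iota> (\<phi> t i)) (\<lambda>i. B t i k) \<noteq> 0"
    using invertible_monomial[of "\<lambda>i. \<iota> (\<phi> t i)"] iota_nonzero by simp
  then show ?thesis
    unfolding y_bin_eq monomial_x_bin monomial_yhat iota_mult iota_monomial g_matrix_c_matrix[OF skew_b]
    by simp
qed

lemma x_bin_Nil: "x_bin \<iota> S [] i = x i"
  by (simp add: x_bin_eq f_Nil F_bin_P_pattern(1)[OF skew_b] iota_one monomial_unit)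

lemma x_bin_Cons:
  "x_bin \<iota> S (k # t) i = (if i = k then monomial (x_bin \<iota> S t) (\<lambda>i. [- B t i k]\<^sub>+) ^ d k
      * ((1 + \<iota> (y_bin S t k) * monomial (x_bin \<iota> S t) (\<lambda>i. B t i k)) ^ d k / \<iota> (1 \<oplus> y_bin S t k) ^ d k)
      / x_bin \<iota> S t k
    else x_bin \<iota> S t i)"
proof (cases "i = k")
  case False
  have "f (k # t) i = f t i" "\<phi> (k # t) i = \<phi> t i"
    unfolding f_Cons F_bin_P_pattern(2)[OF skew_b] cluster_step_def fun_upd_other[OF False] by (rule refl)+
  moreover have "G (k # t) l i = G t l i" for l
    using False by simp
  ultimately show ?thesis
    using False by (simp only: x_bin_eq if_False)
next
  case True
  let ?e = "\<lambda>i. [- B t i k]\<^sub>+" and ?c = "\<lambda>i. - (int (d k) * [- C t i k]\<^sub>+)"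
  let ?Y = "monomial (yhat \<iota> S) (\<lambda>i. C t i k) * monomial (f t) (\<lambda>i. B t i k)"
  let ?p = "\<lambda>i. \<iota> (\<phi> t i)" and ?y = "\<lambda>i. \<iota> (y i)"
  let ?Ge = "monomial x (\<lambda>l. \<Sum>i\<in>UNIV. G t l i * ?e i)" and ?bc = "monomial x (\<lambda>l. \<Sum>i\<in>UNIV. b l i * ?c i)"
  have inv: "invertible (x i)" "invertible (?p i)" "invertible (?y i)" "invertible (f t i)" for i
    by (simp_all add: x_nonzero iota_nonzero f_nonzero)
  have nz: "monomial x e \<noteq> 0" "monomial ?p e \<noteq> 0" "monomial ?y e \<noteq> 0" "monomial (f t) e \<noteq> 0" for e
    using inv invertible_monomial[of x e] invertible_monomial[of ?p e]
      invertible_monomial[of ?y e] invertible_monomial[of "f t" e] by simp_all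
  \<comment> \<open>The g-vector recursion in multiplicative form. The factor \<open>?bc\<close> is
    its last sum, and it is also the x-part of the tropical monomial at yhat.\<close>
  have "monomial x (\<lambda>l. G (k # t) l k) * monomial x (\<lambda>l. G t l k)
      = monomial x (\<lambda>l. (\<Sum>i\<in>UNIV. G t l i * ?e i) * int (d k)) * ?bc"
    unfolding monomial_add[OF inv(1), symmetric]
  proof (rule arg_cong[where f = "monomial x"], rule ext)
    fix l
    have "(\<Sum>i\<in>UNIV. b l i * ?c i) = - (int (d k) * (\<Sum>i\<in>UNIV. b l i * [- C t i k]\<^sub>+))"
      unfolding sum_distrib_left sum_negf[symmetric] by (rule sum.cong) simp_all
    then show "G (k # t) l k + G t l k = (\<Sum>i\<in>UNIV. G t l i * ?e i) * int (d k) + (\<Sum>i\<in>UNIV. b l i * ?c i)"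
      by simp
  qed
  also have "monomial x (\<lambda>l. (\<Sum>i\<in>UNIV. G t l i * ?e i) * int (d k)) = ?Ge ^ d k"
    by (simp add: monomial_scale x_nonzero)
  finally have G: "monomial x (\<lambda>l. G (k # t) l k) = ?Ge ^ d k * ?bc / monomial x (\<lambda>l. G t l k)"
    using nz(1) by (simp add: field_simps)
  have f: "f (k # t) k = monomial (f t) ?e ^ d k * ((1 + ?Y) ^ d k / (monomial ?y ?c * ?bc)) / f t k"
    by (subst f_Cons) (simp add: cluster_step_def monomial_yhat)
  have \<phi>: "\<iota> (\<phi> (k # t) k) = monomial ?p ?e ^ d k * (\<iota> (1 \<oplus> y_bin S t k) ^ d k / monomial ?y ?c) / \<iota> (\<phi> t k)"
    unfolding F_bin_P_pattern(2)[OF skew_b] cluster_step_def fun_upd_same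
    by (simp only: iota_mult iota_divide iota_power iota_monomial y_bin_eq)
  \<comment> \<open>\<open>M\<close> and \<open>N\<close> are the x-part and the y-part of the
    tropical monomial at yhat. \<open>M\<close> comes from the g-vector and from F(yhat);
    \<open>N\<close> comes from F(yhat) and from the value in the semifield.\<close>
  have cancel: "A ^ n * M / g * (P ^ n * (W / (N * M)) / u / (Q ^ n * (V / N) / v))
      = (A * (P / Q)) ^ n * (W / V) / (g * (u / v))"
    if "M \<noteq> 0" "N \<noteq> 0" for A M g P W N u Q V v :: 'f and n
    using that by (simp add: power_mult_distrib power_divide ac_simps)
  have "x_bin \<iota> S (k # t) k = monomial (x_bin \<iota> S t) ?e ^ d k
      * ((1 + \<iota> (y_bin S t k) * monomial (x_bin \<iota> S t) (\<lambda>i. B t i k)) ^ d k / \<iota> (1 \<oplus> y_bin S t k) ^ d k)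
      / x_bin \<iota> S t k"
    unfolding yhat_pattern
    unfolding monomial_x_bin x_bin_eq G f \<phi> by (rule cancel[OF nz(1,3)])
  then show ?thesis using True by simp
qed

text \<open>Scaling row \<open>i\<close> by a nonnegative integer passes through positive parts, and
  the factor \<open>d k\<close> of generalized matrix mutation is supplied by the scaled row
  \<open>k\<close> in the ordinary one.\<close>

lemma left_companion_bmat:
  "matrix_pattern (\<lambda>i j. int (d i) * b i j) (\<lambda>_. 1) t i j = int (d i) * B t i j"
proof (induction t arbitrary: i j)
  case (Cons k t)
  have p: "[int n * c]\<^sub>+ = int n * [c]\<^sub>+" "[- (int n * c)]\<^sub>+ = int n * [- c]\<^sub>+" for n c
    by (simp_all add: max_mult_distrib_left flip: mult_minus_right)
  show ?case unfolding matrix_pattern.simps mutate_matrix_def Cons.IH by (simp add: p algebra_simps)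
qed simp

text \<open>An exponent \<open>d i * b\<close> on the root \<open>r i\<close> is an exponent
  \<open>b\<close> on its \<open>d i\<close>-th power, so the monomials of the companion are
  monomials in \<open>x_bin\<close>, and the \<open>d k\<close>-th power of the ordinary exchange
  relation is \<open>x_bin_Cons\<close>. For the coefficients, row \<open>k\<close> of the scaled
  matrix supplies the factor \<open>d k\<close> in the exponents of y_k and of
  \<open>1 \<oplus> y_k\<close>.\<close>

lemma left_companion_eq:
  assumes r: "\<And>i. r i ^ d i = x i"
  defines "L \<equiv> left_companion \<iota> S r"
  shows "x_bin \<iota> S t i = xcl (L t) i ^ d i \<and> y_bin S t i = yco (L t) i"
proof (induction t arbitrary: i)
  case Nil
  show ?case by (simp add: L_def left_companion_def ordinary_seed_def x_bin_Nil r y_bin_Nil[OF skew_b])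
next
  case (Cons k t)
  let ?x = "xcl (L t)"
  have X: "x_bin \<iota> S t i = ?x i ^ d i" and Y: "y_bin S t i = yco (L t) i" for i
    using Cons.IH by auto
  have bm: "bmat (L t) i j = int (d i) * B t i j" and dg: "degs (L t) i = 1" for i j
    by (simp_all add: L_def left_companion_def ordinary_seed_def left_companion_bmat[unfolded One_nat_def])
  have zc: "zcf (L t) i s = 1" for i s
  proof -
    have "\<forall>i s. zcf (cluster_pattern \<iota> (ordinary_seed r (yco S) (\<lambda>i j. int (degs S i) * bmat S i j)) t) i s = 1" for t
      by (induction t) (simp_all add: ordinary_seed_def mutate_def mutate_coeff_def)
    then show ?thesis by (simp add: L_def left_companion_def)
  qed
  have step: "L (k # t) = mutate \<iota> k (L t)" by (simp add: L_def left_companion_def)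
  have Z: "Z_at (L t) k u = 1 \<oplus> u" for u by (simp add: Z_at_def dg zc)
  have pos: "[int n * c]\<^sub>+ = int n * [c]\<^sub>+" "[- (int n * c)]\<^sub>+ = int n * [- c]\<^sub>+" for n c
    by (simp_all add: max_mult_distrib_left flip: mult_minus_right)
  have mono: "(\<Prod>i\<in>UNIV. ?x i powi (int (d i) * e i)) = monomial (x_bin \<iota> S t) e" for e
    by (simp add: monomial_def X power_int_power)
  have "yco (L (k # t)) i = (if i = k then inverse (yco (L t) k)
      else yco (L t) i * yco (L t) k powi (int (d k) * [B t k i]\<^sub>+) * (1 \<oplus> yco (L t) k) powi (- (int (d k) * B t k i)))"
    by (simp add: step mutate_def mutate_coeff_def bm dg Z pos)
  also have "\<dots> = y_bin S (k # t) i"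
    by (simp add: y_bin_Cons[OF skew_b] Y powi_mult)
  finally have y: "y_bin S (k # t) i = yco (L (k # t)) i" ..
  have "xcl (L (k # t)) i = (if i = k then monomial (x_bin \<iota> S t) (\<lambda>i. [- B t i k]\<^sub>+)
      * ((1 + \<iota> (y_bin S t k) * monomial (x_bin \<iota> S t) (\<lambda>i. B t i k)) / \<iota> (1 \<oplus> y_bin S t k)) / ?x k
    else ?x i)"
    by (simp add: step mutate_def yhat_def bm dg zc Z pos mono iota_one Y)
  then have "x_bin \<iota> S (k # t) i = xcl (L (k # t)) i ^ d i"
    by (simp add: x_bin_Cons X power_mult_distrib power_divide)
  with y show ?case by simp
qed

end

theorem theorem1p1:
  fixes \<iota> :: "'p::semifield \<Rightarrow> 'f::field"
    and S :: "('n::{finite,linorder}, 'p, 'f) seed"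
    and r :: "'n \<Rightarrow> 'f"
  assumes "generalized_seed \<iota> S"
    and "\<And>i. r i ^ degs S i = xcl S i"
    and "t \<in> tree_vertices"
  shows "(\<forall>i. x_bin \<iota> S t i = xcl (left_companion \<iota> S r t) i ^ degs S i)
       \<and> (\<forall>j. y_bin S t j = yco (left_companion \<iota> S r t) j)"
proof -
  interpret binomial_specialization \<iota> S by standard (rule assms(1))
  show ?thesis using left_companion_eq[OF assms(2)] by simp
qed

end
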